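(* Let the phase history $\phi_{H,h}^{n+1}$ and the kinetic histories $\boldsymbol g_{j,H}^{n+1}$, $\boldsymbol\zeta_{H,h}^{n+1}$ be constructed as in the context (with the kinetic transfer being either the fixed-topology or the topology-changing one). Then the following identities hold. (Phase, $k=1$) $$\tau\Bigl[Cn^2\bigl(\nabla\phi_h^{n+1},\nabla\tfrac{\gamma_1}{\tau}(\phi_h^{n+1}-\phi_{H,h}^{n+1})\bigr)_{n+1}+s\bigl(\phi_h^{n+1},\tfrac{\gamma_1}{\tau}(\phi_h^{n+1}-\phi_{H,h}^{n+1})\bigr)_{n+1}\Bigr]=\tfrac12\Bigl[\|\phi_h^{n+1}\|_{Cn,s}^2-\|\phi_h^n\|_{Cn,s}^2+\|\phi_h^{n+1}-\phi_h^n\|_{Cn,s}^2\Bigr].$$ (Phase, $k=2$) $$\tau\Bigl[Cn^2\bigl(\nabla\phi_h^{n+1},\nabla\tfrac{\gamma_2}{\tau}(\phi_h^{n+1}-\phi_{H,h}^{n+1})\bigr)_{n+1}+s\bigl(\phi_h^{n+1},\tfrac{\gamma_2}{\tau}(\phi_h^{n+1}-\phi_{H,h}^{n+1})\bigr)_{n+1}\Bigr]$$ $$=\tfrac14\Bigl[\|\phi_h^{n+1}\|_{Cn,s}^2+\|2\phi_h^{n+1}-\phi_h^n\|_{Cn,s}^2-\|\phi_h^n\|_{Cn,s}^2-\|2\phi_h^n-\phi_h^{n-1}\|_{Cn,s}^2+\|\phi_h^{n+1}-2\phi_h^n+\phi_h^{n-1}\|_{Cn,s}^2\Bigr].$$ (Kinetic,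 $k=1$) $$\gamma_1(\boldsymbol\zeta_h^{n+1}-\boldsymbol\zeta_{H,h}^{n+1},\boldsymbol\zeta_h^{n+1})_{n+1}=\tfrac12\Bigl[\|\boldsymbol g_{0,h}^{n+1}\|_{n+1}^2-\|\boldsymbol g_{0,h}^n\|_n^2+\|\boldsymbol\zeta_h^{n+1}-\boldsymbol g_{0,H}^{n+1}\|_{n+1}^2\Bigr].$$ (Kinetic, $k=2$) $$\gamma_2(\boldsymbol\zeta_h^{n+1}-\boldsymbol\zeta_{H,h}^{n+1},\boldsymbol\zeta_h^{n+1})_{n+1}=\tfrac14\Bigl[\|\boldsymbol g_{0,h}^{n+1}\|_{n+1}^2+\|\boldsymbol g_{1,h}^{n+1}\|_{n+1}^2-\|\boldsymbol g_{0,h}^n\|_n^2-\|\boldsymbol g_{1,h}^n\|_n^2+\|\boldsymbol\zeta_h^{n+1}-\boldsymbol g_{1,H}^{n+1}\|_{n+1}^2\Bigr].$$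
   Context: $\Omega\subset\mathbb R^d$ ($d=2,3$) is a fixed bounded polygonal or polyhedral domain. For each accepted time level $\ell$, $\mathcal T_h^\ell$ is a conforming triangulation of $\Omega$ with conforming finite element spaces $S_h^\ell\subset H^1(\Omega)$ (scalar, containing constants) and $V_h^\ell\subset[H^1(\Omega)]^d$; the meshes and spaces at different levels may differ. $(\cdot,\cdot)_\ell$, $\|\cdot\|_\ell$ and the cross-mesh pairing $\langle\cdot,\cdot\rangle_\times$ all denote the $L^2(\Omega)$ inner product/norm on the fixed domain; the notation only records on which mesh(es) the arguments are represented. $\tau>0$ is the time step, $Cn>0$, $s>0$, $k\in\{1,2\}$, $\gamma_1=1$, $\gamma_2=3/2$, and $$\|v\|_{Cn,s}^2=Cn^2\|\nabla v\|^2+s\|v\|^2 .$$ For $k=2$ take $n\ge1$. Phase history. $\phi_h^\ell\in S_h^\ell$. As a function on $\Omega$ put $\phi_H^{n+1}=\phi_h^n$ if $k=1$ and $\phi_H^{n+1}=(4\phi_h^n-\phi_h^{n-1})/3$ if $k=2$. The current representative $\phi_{H,h}^{n+1}\in S_h^{n+1}$ is defined by $$Cn^2(\nabla\phi_{H,h}^{n+1},\nabla\chi_h)_{n+1}+s(\phi_{H,h}^{n+1},\chi_h)_{n+1}=Cn^2\langle\nabla\phi_H^{n+1},\nabla\chi_h\rangle_\times+s\langle\phi_H^{n+1},\chi_h\rangle_\times\quad\forall\chi_h\in S_h^{n+1}.$$ Kinetic variables. $\boldsymbol u_h^\ell\in V_h^\ell$, $\rho_h^\ell>0$ is the discrete density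 (bounded above and below by positive constants) and $\boldsymbol\zeta_h^\ell=(\rho_h^\ell)^{1/2}\boldsymbol u_h^\ell$. Histories $\boldsymbol g_{j,h}^n$ ($j=0$ for $k=1$; $j=0,1$ for $k=2$) at level $n$ are given, and are transferred to $\boldsymbol g_{j,H}^{n+1}$ at level $n+1$ by one of the following. (a) Fixed topology: there are a common reference triangulation of a reference domain $\widehat\Omega$ and maps $\boldsymbol X_h^\ell:\widehat\Omega\to\Omega$ (bijective, piecewise smooth with admissible inverses) mapping it onto $\mathcal T_h^\ell$, with $J_h^\ell=\det\widehat\nabla\boldsymbol X_h^\ell>0$ (a function on $\widehat\Omega$), and $$\boldsymbol g_{j,H}^{n+1}=\bigl[(J_h^{n+1})^{-1/2}(J_h^n)^{1/2}(\boldsymbol g_{j,h}^n\circ\boldsymbol X_h^n)\bigr]\circ(\boldsymbol X_h^{n+1})^{-1}.$$ (b) Topology change: with $\mathcal P$ the $L^2(\Omega)$-orthogonal projection onto a chosen piecewise-polynomial (vector-valued) history space on $\mathcal T_h^{n+1}$, where it is assumed that $\mathcal P\boldsymbol g_{j,h}^n\neq0$ whenever $\boldsymbol g_{j,h}^n\ne0$, $$\boldsymbol g_{j,H}^{n+1}=\frac{\|\boldsymbol g_{j,h}^n\|_n}{\|\mathcal P\boldsymbol g_{j,h}^n\|_{n+1}}\mathcal P\boldsymbol g_{j,h}^n\quad\text{if }\boldsymbol g_{j,h}^n\ne0,\qquad \boldsymbol g_{j,H}^{n+1}=0\ \text{if }\boldsymbol g_{j,h}^n=0.$$ In both cases one sets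 $\boldsymbol\zeta_{H,h}^{n+1}=\boldsymbol g_{0,H}^{n+1}$ for $k=1$ and $\boldsymbol\zeta_{H,h}^{n+1}=\frac13(2\boldsymbol g_{0,H}^{n+1}+\boldsymbol g_{1,H}^{n+1})$ for $k=2$; and $\boldsymbol g_{0,h}^{n+1}=\boldsymbol\zeta_h^{n+1}$, and, for $k=2$, $\boldsymbol g_{1,h}^{n+1}=2\boldsymbol\zeta_h^{n+1}-\boldsymbol g_{0,H}^{n+1}$ (these relations also hold at level $n$; after a $k=1$ first step, $\boldsymbol g_{1,h}^1=2\boldsymbol\zeta_h^1-\boldsymbol g_{0,H}^1$). *)

theory Defs
  imports "HOL-Analysis.Analysis"
begin

section \<open>Square-integrable functions and weak gradients\<close>

text \<open>
  An element of $L^2(\Omega)$ is represented by a function on the whole space; only its values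
  almost everywhere in \<open>\<Omega>\<close> matter, and equality in $L^2(\Omega)$ is \<open>ae_eq \<Omega>\<close>. All mesh-indexed
  inner products and norms, and the cross-mesh pairing, are \<open>L2_inner \<Omega>\<close> and \<open>L2_norm \<Omega>\<close>.
\<close>

definition ae_eq :: "'a::euclidean_space set \<Rightarrow> ('a \<Rightarrow> 'b) \<Rightarrow> ('a \<Rightarrow> 'b) \<Rightarrow> bool" where
  "ae_eq \<Omega> f g \<longleftrightarrow> (AE x in lebesgue_on \<Omega>. f x = g x)"

definition L2_space :: "'a::euclidean_space set \<Rightarrow> ('a \<Rightarrow> 'b::euclidean_space) set" where
  "L2_space \<Omega> = {f \<in> borel_measurable (lebesgue_on \<Omega>).
     integrable (lebesgue_on \<Omega>) (\<lambda>x. (norm (f x))\<^sup>2)}"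

definition L2_inner ::
    "'a::euclidean_space set \<Rightarrow> ('a \<Rightarrow> 'b::euclidean_space) \<Rightarrow> ('a \<Rightarrow> 'b) \<Rightarrow> real" where
  "L2_inner \<Omega> f g = (LINT x|lebesgue_on \<Omega>. f x \<bullet> g x)"

definition L2_norm :: "'a::euclidean_space set \<Rightarrow> ('a \<Rightarrow> 'b::euclidean_space) \<Rightarrow> real" where
  "L2_norm \<Omega> f = sqrt (L2_inner \<Omega> f f)"

definition partial_deriv :: "'d::finite \<Rightarrow> (real^'d \<Rightarrow> real) \<Rightarrow> real^'d \<Rightarrow> real" where
  "partial_deriv i f x = frechet_derivative f (at x) (axis i 1)"

primrec Ck_function :: "nat \<Rightarrow> (real^'d::finite \<Rightarrow> real) \<Rightarrow> bool" where
  "Ck_function 0 f \<longleftrightarrow> continuous_on UNIV f"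
| "Ck_function (Suc m) f \<longleftrightarrow>
     (\<forall>x. f differentiable (at x)) \<and> (\<forall>i. Ck_function m (partial_deriv i f))"

definition test_functions :: "(real^'d::finite) set \<Rightarrow> (real^'d \<Rightarrow> real) set" where
  "test_functions \<Omega> = {\<psi>. (\<forall>m. Ck_function m \<psi>) \<and>
     (\<exists>C. compact C \<and> C \<subseteq> \<Omega> \<and> (\<forall>x. x \<notin> C \<longrightarrow> \<psi> x = 0))}"

definition is_weak_gradient ::
    "(real^'d::finite) set \<Rightarrow> (real^'d \<Rightarrow> real) \<Rightarrow> (real^'d \<Rightarrow> real^'d) \<Rightarrow> bool" where
  "is_weak_gradient \<Omega> v G \<longleftrightarrow> G \<in> L2_space \<Omega> \<and>
     (\<forall>\<psi>\<in>test_functions \<Omega>. \<forall>i.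
        L2_inner \<Omega> v (partial_deriv i \<psi>) = - L2_inner \<Omega> (\<lambda>x. G x $ i) \<psi>)"

definition H1_space :: "(real^'d::finite) set \<Rightarrow> (real^'d \<Rightarrow> real) set" where
  "H1_space \<Omega> = {v \<in> L2_space \<Omega>. \<exists>G. is_weak_gradient \<Omega> v G}"

text \<open>A representative of the weak gradient, which is unique up to \<open>ae_eq \<Omega>\<close> for \<open>v \<in> H1_space \<Omega>\<close>.\<close>

definition weak_grad :: "(real^'d::finite) set \<Rightarrow> (real^'d \<Rightarrow> real) \<Rightarrow> real^'d \<Rightarrow> real^'d" where
  "weak_grad \<Omega> v = (SOME G. is_weak_gradient \<Omega> v G)"

text \<open>The square $\|v\|_{Cn,s}^2$ of the weighted norm.\<close>

definition Cns_normsq :: "(real^'d::finite) set \<Rightarrow> real \<Rightarrow> real \<Rightarrow> (real^'d \<Rightarrow> real) \<Rightarrow> real" where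
  "Cns_normsq \<Omega> Cn s v = Cn\<^sup>2 * (L2_norm \<Omega> (weak_grad \<Omega> v))\<^sup>2 + s * (L2_norm \<Omega> v)\<^sup>2"

section \<open>Domains, meshes and discrete spaces\<close>

text \<open>A bounded polygonal or polyhedral domain: its boundary consists of finitely many flat pieces
  of codimension one (segments for $d = 2$, convex polygons for $d = 3$).\<close>

definition polyhedral_domain :: "'a::euclidean_space set \<Rightarrow> bool" where
  "polyhedral_domain \<Omega> \<longleftrightarrow> open \<Omega> \<and> connected \<Omega> \<and> \<Omega> \<noteq> {} \<and> bounded \<Omega> \<and>
     (\<exists>F. finite F \<and> (\<forall>P\<in>F. polytope P \<and> aff_dim P = int DIM('a) - 1) \<and> frontier \<Omega> = \<Union>F)"

text \<open>A mesh is the set of its closed full-dimensional cells. Conformity (no hanging nodes) is the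
  common-face condition in \<open>triangulation\<close>. The last condition keeps cells from crossing \<open>frontier \<Omega>\<close>
  when \<open>\<Omega>\<close> has a slit.\<close>

definition conforming_triangulation ::
    "'a::euclidean_space set \<Rightarrow> 'a set set \<Rightarrow> bool" where
  "conforming_triangulation \<Omega> T \<longleftrightarrow> triangulation T \<and> (\<forall>K\<in>T. int DIM('a) simplex K) \<and>
     \<Union>T = closure \<Omega> \<and> (\<forall>K\<in>T. interior K \<subseteq> \<Omega>)"

definition piecewise_polynomial ::
    "'a::euclidean_space set set \<Rightarrow> ('a \<Rightarrow> 'b::euclidean_space) \<Rightarrow> bool" where
  "piecewise_polynomial T v \<longleftrightarrow>
     (\<forall>K\<in>T. \<exists>p. polynomial_function p \<and> (\<forall>x\<in>interior K. v x = p x))"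

text \<open>A finite-dimensional linear space (the span of a finite set \<open>B\<close>) of piecewise polynomials.\<close>

definition piecewise_polynomial_space ::
    "'a::euclidean_space set set \<Rightarrow> ('a \<Rightarrow> 'b::euclidean_space) set \<Rightarrow> bool" where
  "piecewise_polynomial_space T W \<longleftrightarrow>
     (\<exists>B. finite B \<and> W = range (\<lambda>c x. \<Sum>b\<in>B. c b *\<^sub>R b x)) \<and>
     (\<forall>w\<in>W. piecewise_polynomial T w)"

definition scalar_fe_space ::
    "(real^'d::finite) set \<Rightarrow> (real^'d) set set \<Rightarrow> (real^'d \<Rightarrow> real) set \<Rightarrow> bool" where
  "scalar_fe_space \<Omega> T S \<longleftrightarrow> piecewise_polynomial_space T S \<and> S \<subseteq> H1_space \<Omega> \<and>
     (\<forall>c. \<exists>v\<in>S. \<forall>x\<in>\<Omega>. v x = c)"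

definition vector_fe_space ::
    "(real^'d::finite) set \<Rightarrow> (real^'d) set set \<Rightarrow> (real^'d \<Rightarrow> real^'d) set \<Rightarrow> bool" where
  "vector_fe_space \<Omega> T V \<longleftrightarrow> piecewise_polynomial_space T V \<and>
     (\<forall>v\<in>V. \<forall>i. (\<lambda>x. v x $ i) \<in> H1_space \<Omega>)"

section \<open>Phase history\<close>

definition bdf_gamma :: "nat \<Rightarrow> real" where
  "bdf_gamma k = (if k = 1 then 1 else 3/2)"

text \<open>The history combination $\phi_H^{n+1}$; it is used for $k = 1$, and for $k = 2$ with $n \ge 1$.\<close>

definition phase_history :: "nat \<Rightarrow> nat \<Rightarrow> (nat \<Rightarrow> 'a \<Rightarrow> real) \<Rightarrow> 'a \<Rightarrow> real" where
  "phase_history k n \<phi> =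
     (if k = 1 then \<phi> n else (\<lambda>x. (4 * \<phi> n x - \<phi> (n - 1) x) / 3))"

text \<open>\<open>\<phi>Hh\<close> is the representative in \<open>S\<close> of the function \<open>\<phi>H\<close> on \<open>\<Omega>\<close>.\<close>

definition current_representative ::
    "(real^'d::finite) set \<Rightarrow> real \<Rightarrow> real \<Rightarrow> (real^'d \<Rightarrow> real) set \<Rightarrow>
     (real^'d \<Rightarrow> real) \<Rightarrow> (real^'d \<Rightarrow> real) \<Rightarrow> bool" where
  "current_representative \<Omega> Cn s S \<phi>H \<phi>Hh \<longleftrightarrow> \<phi>Hh \<in> S \<and>
     (\<forall>\<eta>\<in>S. Cn\<^sup>2 * L2_inner \<Omega> (weak_grad \<Omega> \<phi>Hh) (weak_grad \<Omega> \<eta>) + s * L2_inner \<Omega> \<phi>Hh \<eta>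
           = Cn\<^sup>2 * L2_inner \<Omega> (weak_grad \<Omega> \<phi>H) (weak_grad \<Omega> \<eta>) + s * L2_inner \<Omega> \<phi>H \<eta>)"

section \<open>Kinetic histories and their transfer\<close>

definition admissible_density :: "'a::euclidean_space set \<Rightarrow> ('a \<Rightarrow> real) \<Rightarrow> bool" where
  "admissible_density \<Omega> \<rho> \<longleftrightarrow> \<rho> \<in> borel_measurable (lebesgue_on \<Omega>) \<and>
     (\<exists>c C. 0 < c \<and> (AE x in lebesgue_on \<Omega>. c \<le> \<rho> x \<and> \<rho> x \<le> C))"

definition C1_map_on :: "(real^'d::finite) set \<Rightarrow> (real^'d \<Rightarrow> real^'d) \<Rightarrow> bool" where
  "C1_map_on U f \<longleftrightarrow> (\<forall>x\<in>U. f differentiable (at x)) \<and>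
     continuous_on U (\<lambda>x. jacobian f (at x))"

definition jac_det :: "(real^'d::finite \<Rightarrow> real^'d) \<Rightarrow> real^'d \<Rightarrow> real" where
  "jac_det X \<xi> = det (jacobian X (at \<xi>))"

text \<open>
  A bijective mesh map from a reference domain \<open>\<Omega>r\<close> with triangulation \<open>Tr\<close> onto \<open>\<Omega>\<close> with
  triangulation \<open>T\<close>, sending cells to cells. Smoothness of the map, the sign of its Jacobian, and
  admissibility of the inverse are required only in the open cells, and only to first order, since
  the map need not be differentiable across cell interfaces.
\<close>

definition mesh_map ::
    "(real^'d::finite) set \<Rightarrow> (real^'d) set set \<Rightarrow> (real^'d) set \<Rightarrow> (real^'d) set set \<Rightarrow>
     (real^'d \<Rightarrow> real^'d) \<Rightarrow> bool" where
  "mesh_map \<Omega>r Tr \<Omega> T X \<longleftrightarrow> bij_betw X \<Omega>r \<Omega> \<and>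
     (\<lambda>K. X ` interior K) ` Tr = interior ` T \<and>
     (\<forall>K\<in>Tr. C1_map_on (interior K) X \<and> (\<forall>\<xi>\<in>interior K. jac_det X \<xi> > 0)) \<and>
     (\<forall>K\<in>T. C1_map_on (interior K) (inv_into \<Omega>r X))"

text \<open>
  Both transfers take the histories \<open>g j\<close>, \<open>j \<in> J\<close>, at the old level to \<open>g' j\<close> at the new level, using the
  same mesh maps, respectively the same history space, for all \<open>j \<in> J\<close>. The meshes \<open>T\<close> and \<open>T'\<close> are
  those of the old and of the new level.
\<close>

definition fixed_topology_transfer ::
    "(real^'d::finite) set \<Rightarrow> (real^'d) set set \<Rightarrow> (real^'d) set set \<Rightarrow> nat set \<Rightarrow>
     (nat \<Rightarrow> real^'d \<Rightarrow> real^'d) \<Rightarrow> (nat \<Rightarrow> real^'d \<Rightarrow> real^'d) \<Rightarrow> bool" where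
  "fixed_topology_transfer \<Omega> T T' J g g' \<longleftrightarrow>
     (\<exists>\<Omega>r Tr X X'. polyhedral_domain \<Omega>r \<and> conforming_triangulation \<Omega>r Tr \<and>
        mesh_map \<Omega>r Tr \<Omega> T X \<and> mesh_map \<Omega>r Tr \<Omega> T' X' \<and>
        (\<forall>j\<in>J. ae_eq \<Omega> (g' j)
           ((\<lambda>\<xi>. (jac_det X' \<xi> powr (-1/2) * jac_det X \<xi> powr (1/2)) *\<^sub>R g j (X \<xi>))
             \<circ> inv_into \<Omega>r X')))"

definition L2_projection ::
    "'a::euclidean_space set \<Rightarrow> ('a \<Rightarrow> 'b::euclidean_space) set \<Rightarrow>
     (('a \<Rightarrow> 'b) \<Rightarrow> 'a \<Rightarrow> 'b) \<Rightarrow> bool" where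
  "L2_projection \<Omega> W P \<longleftrightarrow>
     (\<forall>f\<in>L2_space \<Omega>. P f \<in> W \<and> (\<forall>w\<in>W. L2_inner \<Omega> (\<lambda>x. f x - P f x) w = 0))"

definition topology_change_transfer ::
    "(real^'d::finite) set \<Rightarrow> (real^'d) set set \<Rightarrow> nat set \<Rightarrow>
     (nat \<Rightarrow> real^'d \<Rightarrow> real^'d) \<Rightarrow> (nat \<Rightarrow> real^'d \<Rightarrow> real^'d) \<Rightarrow> bool" where
  "topology_change_transfer \<Omega> T' J g g' \<longleftrightarrow>
     (\<exists>W P. piecewise_polynomial_space T' W \<and> L2_projection \<Omega> W P \<and>
        (\<forall>j\<in>J. \<not> ae_eq \<Omega> (g j) (\<lambda>_. 0) \<longrightarrow> \<not> ae_eq \<Omega> (P (g j)) (\<lambda>_. 0)) \<and>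
        (\<forall>j\<in>J. if ae_eq \<Omega> (g j) (\<lambda>_. 0) then ae_eq \<Omega> (g' j) (\<lambda>_. 0)
               else ae_eq \<Omega> (g' j)
                      (\<lambda>x. (L2_norm \<Omega> (g j) / L2_norm \<Omega> (P (g j))) *\<^sub>R P (g j) x)))"

definition kinetic_transfer ::
    "(real^'d::finite) set \<Rightarrow> (real^'d) set set \<Rightarrow> (real^'d) set set \<Rightarrow> nat set \<Rightarrow>
     (nat \<Rightarrow> real^'d \<Rightarrow> real^'d) \<Rightarrow> (nat \<Rightarrow> real^'d \<Rightarrow> real^'d) \<Rightarrow> bool" where
  "kinetic_transfer \<Omega> T T' J g g' \<longleftrightarrow>
     fixed_topology_transfer \<Omega> T T' J g g' \<or> topology_change_transfer \<Omega> T' J g g'"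

end

theory Submission
  imports Defs
begin

text \<open>
  Each identity is the polarisation identity of a symmetric bilinear form. For the phase field this
  is the form $Cn^2(\nabla v,\nabla w)+s(v,w)$ on $H^1(\Omega)$; testing the equation that defines the
  current representative with $\phi_h^{n+1}$ replaces it by the history combination itself. For the
  kinetic variables it is the $L^2$ inner product, and both transfers are isometries: the first
  because the Jacobian factors are exactly those of the change of variables on each cell, the second
  by normalisation. Bilinearity of the phase form needs the weak gradient to be unique almost
  everywhere, which is the fundamental lemma of the calculus of variations.
\<close>

section \<open>The space L2\<close>

text \<open>\<open>weak_grad\<close> is an arbitrary choice among weak gradients, so the gradients
  of a sum and of its summands have no pointwise relation, and the argument runs up to
  \<open>ae_eq\<close>. The mesh maps are smooth only in the open cells, so the isometry is proved
  on each cell and summed; the reference cells index both decompositions of \<Omega>.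

  Square-integrability has to accompany every norm, since additivity of the integral needs
  integrable summands. In particular \<open>gh 1 n\<close> involves \<open>gH 0 n\<close>, so for
  \<open>k = 2\<close> the transfer from level \<open>n-1\<close> to \<open>n\<close> enters as
  well.

  The two-step identities rest on scalar ones. For the phase it is 2a(3a-4b+c) = a^2 + (2a-b)^2 -
  b^2 - (2b-c)^2 + (a-2b+c)^2. Putting z, a, 2a-b for a, b, c turns it into the kinetic one,
  2z(3z-2a-b) = z^2 + (2z-a)^2 - a^2 - b^2 + (z-b)^2. There a and b are independent vectors, so each
  history may be transferred by itself and only its norm has to survive.\<close>

lemma measurable_ae_eq:
  fixes f g :: "'a::euclidean_space \<Rightarrow> 'b::euclidean_space"
  assumes S: "S \<in> sets lebesgue" and f: "f \<in> borel_measurable (lebesgue_on S)"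
    and eq: "ae_eq S f g"
  shows "g \<in> borel_measurable (lebesgue_on S)"
proof -
  \<comment> \<open>Extension by zero moves the question to \<open>lebesgue\<close>, whose
    completeness lets measurability pass to an almost everywhere equal function.\<close>
  have "AE x in lebesgue. (if x \<in> S then f x else 0) = (if x \<in> S then g x else 0)"
    using eq S unfolding ae_eq_def by (auto simp: AE_restrict_space_iff)
  moreover have "(\<lambda>x. if x \<in> S then f x else 0) \<in> borel_measurable lebesgue"
    using S f by (simp add: borel_measurable_if)
  ultimately have "(\<lambda>x. if x \<in> S then g x else 0) \<in> borel_measurable lebesgue"
    by (rule borel_measurable_AE[rotated])
  with S show ?thesis by (simp add: borel_measurable_if)
qed

lemma ae_eq_sym: "ae_eq S f g \<Longrightarrow> ae_eq S g f"
  by (auto simp: ae_eq_def elim: AE_mp)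

lemma ae_eq_trans: "ae_eq S f g \<Longrightarrow> ae_eq S g h \<Longrightarrow> ae_eq S f h"
  unfolding ae_eq_def by (elim AE_mp) auto

lemma L2_space_ae_eq:
  fixes f g :: "'a::euclidean_space \<Rightarrow> 'b::euclidean_space"
  assumes "S \<in> sets lebesgue" "f \<in> L2_space S" "ae_eq S f g"
  shows "g \<in> L2_space S"
proof -
  have f: "f \<in> borel_measurable (lebesgue_on S)" "integrable (lebesgue_on S) (\<lambda>x. (norm (f x))\<^sup>2)"
    using assms by (auto simp: L2_space_def)
  have g: "g \<in> borel_measurable (lebesgue_on S)"
    using measurable_ae_eq[OF assms(1) f(1) assms(3)] .
  have "integrable (lebesgue_on S) (\<lambda>x. (norm (g x))\<^sup>2)"
    using f g assms(3) unfolding ae_eq_def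
    by (subst integrable_cong_AE[where g="\<lambda>x. (norm (f x))\<^sup>2"]) (auto elim: AE_mp)
  with g show ?thesis by (simp add: L2_space_def)
qed

lemma L2_inner_integrable:
  fixes f g :: "'a::euclidean_space \<Rightarrow> 'b::euclidean_space"
  assumes "f \<in> L2_space S" "g \<in> L2_space S"
  shows "integrable (lebesgue_on S) (\<lambda>x. f x \<bullet> g x)"
proof (rule Bochner_Integration.integrable_bound)
  show "integrable (lebesgue_on S) (\<lambda>x. (norm (f x))\<^sup>2 + (norm (g x))\<^sup>2)"
    using assms by (auto simp: L2_space_def)
  show "(\<lambda>x. f x \<bullet> g x) \<in> borel_measurable (lebesgue_on S)"
    using assms by (auto simp: L2_space_def)
  have "\<bar>u \<bullet> v\<bar> \<le> (norm u)\<^sup>2 + (norm v)\<^sup>2" for u v :: 'b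
  proof -
    have "2 * (norm u * norm v) \<le> (norm u)\<^sup>2 + (norm v)\<^sup>2"
      using sum_squares_bound[of "norm u" "norm v"] by simp
    moreover have "0 \<le> norm u * norm v" by simp
    ultimately show ?thesis using Cauchy_Schwarz_ineq2[of u v] by linarith
  qed
  then show "AE x in lebesgue_on S. norm (f x \<bullet> g x) \<le> norm ((norm (f x))\<^sup>2 + (norm (g x))\<^sup>2)"
    by auto
qed

lemma L2_space_lincomb:
  fixes f g :: "'a::euclidean_space \<Rightarrow> 'b::euclidean_space"
  assumes "f \<in> L2_space S" "g \<in> L2_space S"
  shows "(\<lambda>x. a *\<^sub>R f x + b *\<^sub>R g x) \<in> L2_space S"
proof -
  have m: "f \<in> borel_measurable (lebesgue_on S)" "g \<in> borel_measurable (lebesgue_on S)"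
    using assms by (auto simp: L2_space_def)
  have "integrable (lebesgue_on S)
      (\<lambda>x. a\<^sup>2 * (f x \<bullet> f x) + 2 * a * b * (f x \<bullet> g x) + b\<^sup>2 * (g x \<bullet> g x))"
    using assms by (intro Bochner_Integration.integrable_add integrable_mult_right L2_inner_integrable)
  also have "(\<lambda>x. a\<^sup>2 * (f x \<bullet> f x) + 2 * a * b * (f x \<bullet> g x) + b\<^sup>2 * (g x \<bullet> g x)) =
      (\<lambda>x. (norm (a *\<^sub>R f x + b *\<^sub>R g x))\<^sup>2)"
    unfolding power2_norm_eq_inner
    by (auto simp: inner_add_left inner_add_right inner_commute power2_eq_square algebra_simps)
  finally show ?thesis using m by (simp add: L2_space_def)
qed

lemma L2_inner_lincomb_left:
  fixes f g h :: "'a::euclidean_space \<Rightarrow> 'b::euclidean_space"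
  assumes "f \<in> L2_space S" "g \<in> L2_space S" "h \<in> L2_space S"
  shows "L2_inner S (\<lambda>x. a *\<^sub>R f x + b *\<^sub>R g x) h = a * L2_inner S f h + b * L2_inner S g h"
  using L2_inner_integrable[OF assms(1,3)] L2_inner_integrable[OF assms(2,3)]
  by (simp add: L2_inner_def inner_add_left)

lemma L2_inner_commute: "L2_inner S f g = L2_inner S g f"
  by (simp add: L2_inner_def inner_commute)

lemma L2_inner_lincomb_right:
  fixes f g h :: "'a::euclidean_space \<Rightarrow> 'b::euclidean_space"
  assumes "f \<in> L2_space S" "g \<in> L2_space S" "h \<in> L2_space S"
  shows "L2_inner S h (\<lambda>x. a *\<^sub>R f x + b *\<^sub>R g x) = a * L2_inner S h f + b * L2_inner S h g"
  using L2_inner_lincomb_left[OF assms] by (simp add: L2_inner_commute)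

lemma L2_norm_power2: "(L2_norm S f)\<^sup>2 = L2_inner S f f"
  unfolding L2_norm_def L2_inner_def by (simp add: integral_nonneg)

lemma L2_inner_cong:
  fixes f g :: "'a::euclidean_space \<Rightarrow> 'b::euclidean_space"
  assumes S: "S \<in> sets lebesgue" and f: "f \<in> L2_space S" "ae_eq S f f'"
    and g: "g \<in> L2_space S" "ae_eq S g g'"
  shows "L2_inner S f g = L2_inner S f' g'"
proof -
  have "f' \<in> L2_space S" "g' \<in> L2_space S"
    using L2_space_ae_eq[OF S] f g by auto
  with f g show ?thesis
    unfolding L2_inner_def ae_eq_def
    by (intro integral_cong_AE) (auto simp: L2_space_def elim: AE_mp)
qed

lemma L2_norm_cong:
  fixes f :: "'a::euclidean_space \<Rightarrow> 'b::euclidean_space"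
  assumes "S \<in> sets lebesgue" "f \<in> L2_space S" "ae_eq S f f'"
  shows "L2_norm S f = L2_norm S f'"
  unfolding L2_norm_def using L2_inner_cong[OF assms(1-3) assms(2,3)] by simp

text \<open>Definiteness links the two ways in which a vanishing projection appears: the topology
  change excludes it almost everywhere, while its scaling divides by the norm.\<close>

lemma L2_norm_eq_0:
  fixes f :: "'a::euclidean_space \<Rightarrow> 'b::euclidean_space"
  assumes "f \<in> L2_space S" "L2_norm S f = 0"
  shows "ae_eq S f (\<lambda>_. 0)"
proof -
  have "L2_inner S f f = 0" using assms(2) L2_norm_power2[of S f] by simp
  then have "AE x in lebesgue_on S. f x \<bullet> f x = 0"
    unfolding L2_inner_def
    using integral_nonneg_eq_0_iff_AE[OF L2_inner_integrable[OF assms(1,1)]] by auto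
  then show ?thesis by (simp add: ae_eq_def)
qed

section \<open>Smooth functions with compact support\<close>

lemma partial_deriv_eq:
  "(f has_derivative D) (at x) \<Longrightarrow> partial_deriv i f x = D (axis i 1)"
  unfolding partial_deriv_def by (metis frechet_derivative_at)

text \<open>Uniqueness of the derivative allows any explicit formula \<open>D\<close> in place of
  \<open>frechet_derivative\<close>, so the usual differentiation rules can be used.\<close>

lemma Ck_function_SucI:
  assumes "\<And>x. (f has_derivative D x) (at x)" "\<And>i. Ck_function m (\<lambda>x. D x (axis i 1))"
  shows "Ck_function (Suc m) f"
proof -
  have "partial_deriv i f = (\<lambda>x. D x (axis i 1))" for i
    using partial_deriv_eq[OF assms(1)] by auto
  with assms show ?thesis by (auto simp: differentiable_def)
qed

lemma Ck_function_continuous: "Ck_function m f \<Longrightarrow> continuous_on UNIV f"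
  by (cases m) (auto intro!: differentiable_imp_continuous_on simp: differentiable_on_def)

lemma Ck_function_Suc_imp: "Ck_function (Suc m) f \<Longrightarrow> Ck_function m f"
proof (induction m arbitrary: f)
  case 0 then show ?case using Ck_function_continuous[of "Suc 0"] by simp
next
  case (Suc m)
  have "\<forall>x. f differentiable (at x)" "\<And>i. Ck_function (Suc m) (partial_deriv i f)"
    using Suc.prems by auto
  then show ?case using Suc.IH by auto
qed

lemma Ck_function_const: "Ck_function m (\<lambda>x. c)"
proof (induction m arbitrary: c)
  case (Suc m) then show ?case
    by (intro Ck_function_SucI[where D="\<lambda>x h. 0"]) auto
qed simp

lemma Ck_function_nth: "Ck_function m (\<lambda>x. x $ i)"
proof (cases m)
  case (Suc k) show ?thesis
    unfolding Suc by (rule Ck_function_SucI[where D="\<lambda>x h. h $ i"])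
      (auto intro: Ck_function_const bounded_linear_imp_has_derivative bounded_linear_vec_nth)
qed (auto intro: continuous_intros)

lemma Ck_function_has_derivative:
  assumes "Ck_function (Suc m) f"
  shows "(f has_derivative frechet_derivative f (at x)) (at x)"
    "Ck_function m (\<lambda>x. frechet_derivative f (at x) (axis i 1))"
  using assms by (auto simp: partial_deriv_def[abs_def] frechet_derivative_works)

lemma Ck_function_add:
  "Ck_function m f \<Longrightarrow> Ck_function m g \<Longrightarrow> Ck_function m (\<lambda>x. f x + g x)"
proof (induction m arbitrary: f g)
  case 0 then show ?case by (auto intro: continuous_on_add)
next
  case (Suc m)
  note F = Ck_function_has_derivative[OF Suc.prems(1)]
  note G = Ck_function_has_derivative[OF Suc.prems(2)]
  show ?case
    by (rule Ck_function_SucI, rule has_derivative_add[OF F(1) G(1)]) (intro Suc.IH F G)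
qed

text \<open>The product rule keeps one factor undifferentiated in each term; lowering the order of
  these factors by \<open>Ck_function_Suc_imp\<close> makes the induction hypothesis
  applicable.\<close>

lemma Ck_function_mult:
  "Ck_function m f \<Longrightarrow> Ck_function m g \<Longrightarrow> Ck_function m (\<lambda>x. f x * g x)"
proof (induction m arbitrary: f g)
  case 0 then show ?case by (auto intro: continuous_on_mult)
next
  case (Suc m)
  note F = Ck_function_has_derivative[OF Suc.prems(1)]
  note G = Ck_function_has_derivative[OF Suc.prems(2)]
  have "Ck_function m f" "Ck_function m g" using Suc.prems by (auto intro: Ck_function_Suc_imp)
  then show ?case
    by (intro Ck_function_SucI[OF has_derivative_mult[OF F(1) G(1)]] Ck_function_add Suc.IH F(2) G(2))
qed

lemma Ck_function_diff:
  assumes "Ck_function m f" "Ck_function m g" shows "Ck_function m (\<lambda>x. f x - g x)"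
  using Ck_function_add[OF assms(1) Ck_function_mult[OF Ck_function_const[of m "-1"] assms(2)]]
  by simp

lemma Ck_function_power: "Ck_function m f \<Longrightarrow> Ck_function m (\<lambda>x. f x ^ n)"
  by (induction n) (auto intro: Ck_function_const Ck_function_mult)

lemma Ck_function_sum: "(\<And>i. i \<in> I \<Longrightarrow> Ck_function m (f i)) \<Longrightarrow> Ck_function m (\<lambda>x. \<Sum>i\<in>I. f i x)"
  by (induction I rule: infinite_finite_induct) (auto intro: Ck_function_const Ck_function_add)

lemma Ck_function_prod: "(\<And>i. i \<in> I \<Longrightarrow> Ck_function m (f i)) \<Longrightarrow> Ck_function m (\<lambda>x. \<Prod>i\<in>I. f i x)"
  by (induction I rule: infinite_finite_induct) (auto intro: Ck_function_const Ck_function_mult)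

text \<open>For $p = 1$ this is the classical $e^{-1/t}$; the family over all polynomials $p$ is closed
  under differentiation.\<close>

definition flat :: "real poly \<Rightarrow> real \<Rightarrow> real" where
  "flat p t = (if t > 0 then poly p (inverse t) * exp (- inverse t) else 0)"

section \<open>The flat function at zero and bump functions\<close>

lemma poly_times_exp_minus_tendsto_0:
  "((\<lambda>y::real. poly p y * exp (- y)) \<longlongrightarrow> 0) at_top"
proof -
  have "((\<lambda>y::real. \<Sum>i\<le>degree p. coeff p i * (y ^ i / exp y)) \<longlongrightarrow> (\<Sum>i\<le>degree p. coeff p i * 0)) at_top"
    by (intro tendsto_sum tendsto_mult tendsto_const tendsto_power_div_exp_0)
  then show ?thesis
    by (simp add: poly_altdef sum_distrib_left exp_minus divide_inverse mult_ac)
qed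

text \<open>With y = 1/t, the derivative of p(y) exp(-y) in t is y^2 (p(y) - p'(y)) exp(-y), which
  gives the polynomial in the statement. At t = 0 exponential decay beats every polynomial in
  y.\<close>

lemma flat_has_real_derivative:
  "(flat p has_real_derivative flat (monom 1 2 * (p - pderiv p)) t) (at t)"
proof -
  consider "t > 0" | "t < 0" | "t = 0" by linarith
  then show ?thesis
  proof cases
    case 1
    have "((\<lambda>t. poly p (inverse t) * exp (- inverse t)) has_real_derivative
        flat (monom 1 2 * (p - pderiv p)) t) (at t)"
      using 1 by (auto intro!: derivative_eq_intros DERIV_chain'[OF _ poly_DERIV] 
          simp: flat_def poly_monom power2_eq_square algebra_simps)
    then show ?thesis
      by (rule has_field_derivative_transform_within_open[where S="{0<..}"])
        (use 1 in \<open>auto simp: flat_def\<close>)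
  next
    case 2
    have "((\<lambda>t. 0) has_real_derivative flat (monom 1 2 * (p - pderiv p)) t) (at t)"
      using 2 by (auto simp: flat_def)
    then show ?thesis
      by (rule has_field_derivative_transform_within_open[where S="{..<0}"])
        (use 2 in \<open>auto simp: flat_def\<close>)
  next
    case 3
    have "((\<lambda>h. flat p h / h) \<longlongrightarrow> 0) (at_right 0)"
    proof (rule Lim_transform_eventually)
      \<comment> \<open>The difference quotient carries one more factor \<open>inverse h\<close>,
        and \<open>pCons 0 p\<close> is the polynomial y p(y).\<close>
      show "((\<lambda>h. poly (pCons 0 p) (inverse h) * exp (- inverse h)) \<longlongrightarrow> 0) (at_right (0::real))"
        by (rule filterlim_compose[OF poly_times_exp_minus_tendsto_0 filterlim_inverse_at_top_right])
      show "\<forall>\<^sub>F h in at_right 0. poly (pCons 0 p) (inverse h) * exp (- inverse h) = flat p h / h"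
        by (auto simp: eventually_at_right_field flat_def divide_inverse intro!: exI[of _ 1])
    qed
    moreover have "((\<lambda>h. flat p h / h) \<longlongrightarrow> 0) (at_left 0)"
      by (rule Lim_transform_eventually[OF tendsto_const])
        (auto simp: eventually_at_left_field flat_def intro!: exI[of _ "-1"])
    ultimately show ?thesis
      using 3 by (auto simp: DERIV_def filterlim_at_split flat_def)
  qed
qed

text \<open>Differentiation changes the polynomial and brings in a factor from \<open>h\<close>, so
  the induction is over all \<open>p\<close> at once and \<open>h\<close> is taken smooth of every
  order.\<close>

lemma Ck_function_flat:
  assumes "\<And>m. Ck_function m h" shows "Ck_function m (\<lambda>x. flat p (h x))"
proof (induction m arbitrary: p)
  case 0
  have "continuous_on UNIV (flat p)"
    using flat_has_real_derivative
    by (meson DERIV_isCont continuous_at_imp_continuous_on)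
  then show ?case
    using Ck_function_continuous[OF assms] by (auto intro: continuous_on_compose2)
next
  case (Suc m)
  note H = Ck_function_has_derivative[OF assms]
  have "((\<lambda>x. flat p (h x)) has_derivative
      (\<lambda>y. frechet_derivative h (at x) y * flat (monom 1 2 * (p - pderiv p)) (h x))) (at x)" for x
    using has_derivative_compose[OF H(1) flat_has_real_derivative[of p "h x", unfolded has_field_derivative_def]]
    by (simp add: mult.commute)
  then show ?case
    by (rule Ck_function_SucI) (intro Ck_function_mult H(2) Suc.IH)
qed

text \<open>The standard bump exp(-1/(r^2 - |x-a|^2)) on a ball. The squared norm is a polynomial in
  the coordinates, hence smooth also at the centre.\<close>

definition bump :: "real^'d::finite \<Rightarrow> real \<Rightarrow> real^'d \<Rightarrow> real" where
  "bump a r x = flat 1 (r\<^sup>2 - (norm (x - a))\<^sup>2)"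

lemma Ck_function_bump: "Ck_function m (bump a r)"
proof -
  have "bump a r = (\<lambda>x. flat 1 (r\<^sup>2 - (\<Sum>i\<in>UNIV. (x $ i - a $ i)\<^sup>2)))"
    by (simp add: fun_eq_iff bump_def power2_norm_eq_inner inner_vec_def flip: power2_eq_square)
  then show ?thesis
    by (auto intro!: Ck_function_flat Ck_function_diff Ck_function_const Ck_function_sum
        Ck_function_power Ck_function_nth)
qed

lemma bump_bounds: "0 \<le> bump a r x" "bump a r x \<le> 1"
  by (auto simp: bump_def flat_def)

lemma bump_pos_iff:
  assumes "r > 0" shows "bump a r x > 0 \<longleftrightarrow> x \<in> ball a r"
proof -
  have "(norm (x - a))\<^sup>2 < r\<^sup>2 \<longleftrightarrow> norm (x - a) < r"
    using assms by (metis less_imp_le norm_ge_zero power2_less_imp_less power_strict_mono zero_less_numeral)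
  then show ?thesis
    by (auto simp: bump_def flat_def dist_norm norm_minus_commute)
qed

lemma test_functions_mono: "S \<subseteq> U \<Longrightarrow> test_functions S \<subseteq> test_functions U"
  unfolding test_functions_def by blast

lemma test_functions_continuous: "\<psi> \<in> test_functions \<Omega> \<Longrightarrow> continuous_on UNIV \<psi>"
  unfolding test_functions_def using Ck_function_continuous by blast

text \<open>A countable family of balls, whose closed balls lie in \<open>U\<close>, covers
  \<open>U\<close>, each with a bump positive exactly on it. Combining the first n bumps gives
  compact support in \<open>U\<close>; raising to the n-th power pushes the value to 1 wherever some
  bump is positive. This replaces mollification below.\<close>

lemma open_indicator_test_functions:
  fixes U :: "(real^'d::finite) set"
  assumes "open U"
  obtains \<psi> :: "nat \<Rightarrow> real^'d \<Rightarrow> real" where "\<And>n. \<psi> n \<in> test_functions U"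
    "\<And>n x. \<bar>\<psi> n x\<bar> \<le> 1" "\<And>x. (\<lambda>n. \<psi> n x) \<longlonglongrightarrow> indicator U x"
proof (cases "U = {}")
  case True
  have "(\<lambda>_. 0) \<in> test_functions U"
    by (auto simp: test_functions_def Ck_function_const intro!: exI[of _ "{}"])
  then show thesis using True that[of "\<lambda>_ _. 0"] by auto
next
  case False
  define F where "F = {(a, r). r > 0 \<and> cball a r \<subseteq> U}"
  have U: "U = (\<Union>(a, r)\<in>F. ball a r)"
  proof
    show "U \<subseteq> (\<Union>(a, r)\<in>F. ball a r)"
    proof
      fix x assume "x \<in> U"
      with assms obtain r where "r > 0" "cball x r \<subseteq> U" by (meson open_contains_cball)
      then show "x \<in> (\<Union>(a, r)\<in>F. ball a r)" by (intro UN_I[of "(x, r)"]) (auto simp: F_def)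
    qed
  qed (force simp: F_def)
  obtain B where B: "B \<subseteq> (\<lambda>(a, r). ball a r) ` F" "countable B" "\<Union>B = \<Union>((\<lambda>(a, r). ball a r) ` F)"
    by (rule Lindelof[of "(\<lambda>(a, r). ball a r) ` F"]) auto
  obtain G where G: "countable G" "G \<subseteq> F" "B = (\<lambda>(a, r). ball a r) ` G"
    using B(1,2) countable_subset_image[of B "\<lambda>(a, r). ball a r" F] by auto
  have UG: "U = (\<Union>(a, r)\<in>G. ball a r)" using U B G by metis
  with False have "G \<noteq> {}" by auto
  \<comment> \<open>The enumeration may repeat balls, which is harmless. It requires a nonempty
    family, so the empty \<open>U\<close> was treated separately.\<close>
  define c where "c = from_nat_into G"
  have c: "range c = G" unfolding c_def using \<open>G \<noteq> {}\<close> G(1) by (rule range_from_nat_into)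
  define b where "b i = bump (fst (c i)) (snd (c i))" for i
  have cF: "snd (c i) > 0" "cball (fst (c i)) (snd (c i)) \<subseteq> U" for i
  proof -
    have "c i \<in> F" using c G(2) by auto
    then show "snd (c i) > 0" "cball (fst (c i)) (snd (c i)) \<subseteq> U" by (auto simp: F_def)
  qed
  have b01: "0 \<le> b i x" "b i x \<le> 1" for i x by (auto simp: b_def bump_bounds)
  have b0: "b i x = 0" if "x \<notin> ball (fst (c i)) (snd (c i))" for i x
    using that bump_pos_iff[OF cF(1), of "fst (c i)"  i x] b01(1)[of i x] by (force simp: b_def)
  \<comment> \<open>Only the first \<open>n\<close> bumps enter, so the support stays in finitely
    many closed balls. At a point of the i-th ball the single factor (1 - b i x)^n, present once n >
    i, already forces the product to 0, the other factors being at most 1.\<close>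
  define \<psi> where "\<psi> n x = 1 - (\<Prod>i<n. (1 - b i x) ^ n)" for n x
  have prod01: "0 \<le> (\<Prod>i<n. (1 - b i x) ^ n)" "(\<Prod>i<n. (1 - b i x) ^ n) \<le> 1" for n x
    using b01 by (auto intro!: prod_nonneg prod_le_1 power_le_one)
  show thesis
  proof
    fix n
    have "Ck_function m (\<psi> n)" for m
      unfolding \<psi>_def b_def
      by (intro Ck_function_diff Ck_function_const Ck_function_prod Ck_function_power Ck_function_bump)
    moreover have "compact (\<Union>i<n. cball (fst (c i)) (snd (c i)))"
      by (intro compact_UN) auto
    moreover have "(\<Union>i<n. cball (fst (c i)) (snd (c i))) \<subseteq> U" using cF by blast
    moreover have "\<psi> n x = 0" if "x \<notin> (\<Union>i<n. cball (fst (c i)) (snd (c i)))" for x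
    proof -
      have "b i x = 0" if "i < n" for i
        using that \<open>x \<notin> _\<close> b0[of x i] by fastforce
      then show ?thesis by (simp add: \<psi>_def)
    qed
    ultimately show "\<psi> n \<in> test_functions U"
      unfolding test_functions_def by blast
  next
    fix n x show "\<bar>\<psi> n x\<bar> \<le> 1" using prod01[of x n] by (simp add: \<psi>_def abs_le_iff)
  next
    fix x show "(\<lambda>n. \<psi> n x) \<longlonglongrightarrow> indicator U x"
    proof (cases "x \<in> U")
      case False
      then have "b i x = 0" for i
        using cF(2)[of i] ball_subset_cball[of "fst (c i)" "snd (c i)"] by (intro b0) blast
      then show ?thesis using False by (simp add: \<psi>_def)
    next
      case True
      then obtain p where "p \<in> G" and p: "x \<in> ball (fst p) (snd p)"
        unfolding UG by auto
      then obtain i where "p = c i" using c by auto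
      with p have i: "x \<in> ball (fst (c i)) (snd (c i))" by simp
      have pos: "b i x > 0" using i bump_pos_iff[OF cF(1), of "fst (c i)" i x] by (simp add: b_def)
      have "(\<lambda>n. \<Prod>j<n. (1 - b j x) ^ n) \<longlonglongrightarrow> 0"
      proof (rule tendsto_sandwich[OF _ _ tendsto_const])
        show "(\<lambda>n. (1 - b i x) ^ n) \<longlonglongrightarrow> 0"
          using pos b01(2)[of i x] by (intro LIMSEQ_power_zero) auto
        have "(\<Prod>j<n. (1 - b j x) ^ n) \<le> (1 - b i x) ^ n" if "n > i" for n
        proof -
          have "(\<Prod>j<n. (1 - b j x) ^ n) = (1 - b i x) ^ n * (\<Prod>j\<in>{..<n} - {i}. (1 - b j x) ^ n)"
            using that by (intro prod.remove) auto
          also have "\<dots> \<le> (1 - b i x) ^ n * 1"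
            using b01 by (intro mult_left_mono prod_le_1) (auto intro: power_le_one)
          finally show ?thesis by simp
        qed
        then show "\<forall>\<^sub>F n in sequentially. (\<Prod>j<n. (1 - b j x) ^ n) \<le> (1 - b i x) ^ n"
          by (auto intro: eventually_mono[OF eventually_gt_at_top[of i]])
      qed (auto intro: always_eventually prod01)
      then have "(\<lambda>n. 1 - (\<Prod>j<n. (1 - b j x) ^ n)) \<longlonglongrightarrow> 1 - 0"
        by (intro tendsto_diff tendsto_const)
      then show ?thesis using True by (simp add: \<psi>_def)
    qed
  qed
qed

section \<open>Uniqueness and linearity of the weak gradient\<close>

lemma compact_support_bounded:
  fixes f :: "'a::euclidean_space \<Rightarrow> real"
  assumes "continuous_on UNIV f" "compact C" "\<And>x. x \<notin> C \<Longrightarrow> f x = 0"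
  obtains B where "\<And>x. \<bar>f x\<bar> \<le> B"
proof -
  have "bounded (f ` C)"
    using assms(1,2) by (meson compact_continuous_image compact_imp_bounded continuous_on_subset top_greatest)
  then obtain B where "B > 0" "\<forall>x\<in>C. \<bar>f x\<bar> \<le> B" by (auto simp: bounded_pos)
  then have "\<bar>f x\<bar> \<le> B" for x using assms(3)[of x] by (cases "x \<in> C") auto
  then show thesis by (rule that)
qed

text \<open>The complement of the support set \<open>C\<close> is open and \<psi> vanishes on it, so
  the derivative vanishes there too and the same \<open>C\<close> serves.\<close>

lemma partial_deriv_test_functions:
  assumes "\<psi> \<in> test_functions \<Omega>" shows "partial_deriv i \<psi> \<in> test_functions \<Omega>"
proof -
  from assms obtain C where C: "compact C" "C \<subseteq> \<Omega>" "\<And>x. x \<notin> C \<Longrightarrow> \<psi> x = 0"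
    and k: "\<And>m. Ck_function m \<psi>" by (auto simp: test_functions_def)
  have "partial_deriv i \<psi> x = 0" if "x \<notin> C" for x
  proof -
    have "((\<lambda>_. 0) has_derivative (\<lambda>_. 0)) (at x)" by simp
    then have "(\<psi> has_derivative (\<lambda>_. 0)) (at x)"
      by (rule has_derivative_transform_within_open[where s="- C"])
        (use that C in \<open>auto simp: compact_imp_closed\<close>)
    from partial_deriv_eq[OF this] show ?thesis by simp
  qed
  moreover have "Ck_function m (partial_deriv i \<psi>)" for m using k[of "Suc m"] by simp
  ultimately show ?thesis using C by (auto simp: test_functions_def)
qed

lemma bounded_L2_space:
  fixes f :: "'a::euclidean_space \<Rightarrow> 'b::euclidean_space"
  assumes "\<Omega> \<in> lmeasurable" "f \<in> borel_measurable (lebesgue_on \<Omega>)" "AE x in lebesgue_on \<Omega>. norm (f x) \<le> B"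
  shows "f \<in> L2_space \<Omega>"
proof -
  interpret finite_measure "lebesgue_on \<Omega>" using assms(1) by (rule finite_measure_lebesgue_on)
  have "integrable (lebesgue_on \<Omega>) (\<lambda>x. (norm (f x))\<^sup>2)"
    by (rule integrable_const_bound[where B="B\<^sup>2"]) (use assms in \<open>auto elim!: AE_mp intro!: power_mono\<close>)
  with assms show ?thesis by (simp add: L2_space_def)
qed

lemma test_functions_L2_space:
  assumes "\<Omega> \<in> lmeasurable" "\<psi> \<in> test_functions \<Omega>"
  shows "\<psi> \<in> L2_space \<Omega>"
proof -
  have c: "continuous_on UNIV \<psi>"
    using assms(2) by (rule test_functions_continuous)
  obtain C where C: "compact C" "\<And>x. x \<notin> C \<Longrightarrow> \<psi> x = 0"
    using assms(2) by (auto simp: test_functions_def)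
  obtain B where "\<And>x. \<bar>\<psi> x\<bar> \<le> B" using compact_support_bounded[OF c C] by blast
  moreover have "\<psi> \<in> borel_measurable (lebesgue_on \<Omega>)"
    using borel_measurable_continuous_onI[OF c]
    by (intro measurable_restrict_space1 measurable_completion) auto
  ultimately show ?thesis using bounded_L2_space[OF assms(1), of \<psi> B] by auto
qed

text \<open>The functions f with integral of g f equal to 0 are closed under pointwise limits
  bounded by 1. This carries the hypothesis from test functions to indicators of open sets, of
  countable intersections of open sets, and of all Lebesgue sets; the sets where g is positive or
  negative then finish.\<close>

lemma fundamental_lemma:
  fixes g :: "real^'d::finite \<Rightarrow> real"
  assumes \<Omega>: "open \<Omega>" and g: "integrable (lebesgue_on \<Omega>) g"
    and test: "\<And>\<psi>. \<psi> \<in> test_functions \<Omega> \<Longrightarrow> (LINT x|lebesgue_on \<Omega>. g x * \<psi> x) = 0"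
  shows "AE x in lebesgue_on \<Omega>. g x = 0"
proof -
  have \<Omega>_sets: "\<Omega> \<in> sets lebesgue" using \<Omega> by auto
  have bm: "f \<in> borel_measurable (lebesgue_on \<Omega>)" if "f \<in> borel_measurable lebesgue" for f :: "real^'d \<Rightarrow> real"
    using that by (rule measurable_restrict_space1)
  have gm: "g \<in> borel_measurable (lebesgue_on \<Omega>)" using g by auto
  \<comment> \<open>Dominated convergence with majorant |g|; this is why all approximants are
    bounded by 1.\<close>
  have limit: "(LINT x|lebesgue_on \<Omega>. g x * f x) = 0"
    if zero: "\<And>n::nat. (LINT x|lebesgue_on \<Omega>. g x * s n x) = 0"
      and conv: "\<And>x. x \<in> \<Omega> \<Longrightarrow> (\<lambda>n. s n x) \<longlonglongrightarrow> f x" and bound: "\<And>n x. \<bar>s n x\<bar> \<le> 1"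
      and meas: "f \<in> borel_measurable lebesgue" "\<And>n. s n \<in> borel_measurable lebesgue" for s f
  proof -
    have "(\<lambda>n. LINT x|lebesgue_on \<Omega>. g x * s n x) \<longlonglongrightarrow> (LINT x|lebesgue_on \<Omega>. g x * f x)"
    proof (rule integral_dominated_convergence[where w="\<lambda>x. \<bar>g x\<bar>"])
      show "AE x in lebesgue_on \<Omega>. (\<lambda>n. g x * s n x) \<longlonglongrightarrow> g x * f x"
        by (rule AE_I2) (auto intro!: tendsto_mult conv)
      show "AE x in lebesgue_on \<Omega>. norm (g x * s n x) \<le> \<bar>g x\<bar>" for n
        using bound[of n] by (intro AE_I2) (simp add: abs_mult mult_left_le)
      show "(\<lambda>x. g x * f x) \<in> borel_measurable (lebesgue_on \<Omega>)"
        by (intro borel_measurable_times gm bm meas)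
      show "(\<lambda>x. g x * s n x) \<in> borel_measurable (lebesgue_on \<Omega>)" for n
        by (intro borel_measurable_times gm bm meas)
    qed (use g in simp)
    then show ?thesis by (simp add: zero LIMSEQ_const_iff)
  qed
  \<comment> \<open>Approximating on \<open>U \<inter> \<Omega>\<close> keeps the test functions
    supported in \<Omega>, and on \<Omega> its indicator agrees with that of
    \<open>U\<close>.\<close>
  have "open": "(LINT x|lebesgue_on \<Omega>. g x * indicator U x) = 0" if "open U" for U
  proof -
    obtain \<psi> :: "nat \<Rightarrow> real^'d \<Rightarrow> real" where \<psi>: "\<And>n. \<psi> n \<in> test_functions (U \<inter> \<Omega>)"
      "\<And>n x. \<bar>\<psi> n x\<bar> \<le> 1" "\<And>x. (\<lambda>n. \<psi> n x) \<longlonglongrightarrow> indicator (U \<inter> \<Omega>) x"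
      by (rule open_indicator_test_functions[OF open_Int[OF \<open>open U\<close> \<Omega>]]) (rule that)
    have t: "\<psi> n \<in> test_functions \<Omega>" for n using \<psi>(1) test_functions_mono[of "U \<inter> \<Omega>" \<Omega>] by blast
    show ?thesis
    proof (rule limit[of \<psi>])
      show "(\<lambda>n. \<psi> n x) \<longlonglongrightarrow> indicator U x" if "x \<in> \<Omega>" for x
        using \<psi>(3)[of x] that by (simp add: indicator_def)
      have "continuous_on UNIV (\<psi> n)" for n
        using t by (rule test_functions_continuous)
      then show "\<psi> n \<in> borel_measurable lebesgue" for n
        by (intro measurable_completion) (simp add: borel_measurable_continuous_onI)
    qed (use t test \<psi> that in \<open>auto intro!: borel_measurable_indicator\<close>)
  qed
  have set: "(LINT x|lebesgue_on \<Omega>. g x * indicator A x) = 0" if A: "A \<in> sets lebesgue" for A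
  proof -
    \<comment> \<open>Regularity: up to a null set, \<open>A\<close> is a countable intersection of
      open sets, whose indicator is the limit of those of the finite intersections
      \<open>U n\<close>.\<close>
    obtain C N where C: "gdelta C" and N: "N \<in> null_sets lebesgue" "A \<union> N = C" "disjnt A N"
      using lebesgue_set_almost_gdelta[OF A] .
    from C obtain F :: "nat \<Rightarrow> (real^'d) set" where F: "\<And>n. open (F n)" "C = \<Inter>(range F)"
      by (auto elim: gdelta.cases)
    define U where "U n = (\<Inter>i\<le>n. F i)" for n
    have "open (U n)" for n using F by (auto simp: U_def)
    have zero: "(LINT x|lebesgue_on \<Omega>. g x * indicator C x) = 0"
    proof (rule limit[of "\<lambda>n. indicator (U n)"])
      show "(\<lambda>n. indicator (U n) x) \<longlonglongrightarrow> indicat_real C x" for x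
      proof (cases "x \<in> C")
        case True then show ?thesis by (auto simp: F U_def)
      next
        case False
        then obtain k where "x \<notin> F k" by (auto simp: F)
        then have "\<forall>\<^sub>F n in sequentially. indicat_real (U n) x = 0"
          by (intro eventually_mono[OF eventually_ge_at_top[of k]]) (auto simp: U_def indicator_def)
        then show ?thesis using False by (simp add: tendsto_eventually)
      qed
    qed (use \<open>open (U _)\<close> "open" A N in \<open>auto intro!: borel_measurable_indicator\<close>)
    have "AE x in lebesgue_on \<Omega>. g x * indicator C x = g x * indicator A x"
    proof -
      have "AE x in lebesgue. x \<notin> N" using N(1) by (rule AE_not_in)
      then have "AE x in lebesgue_on \<Omega>. x \<notin> N" using \<Omega>_sets by (auto simp: AE_restrict_space_iff elim!: eventually_mono)
      then show ?thesis using N(2) by (auto elim!: AE_mp simp: indicator_def)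
    qed
    moreover have "C \<in> sets lebesgue" using N A by (metis null_setsD2 sets.Un)
    then have "(\<lambda>x. g x * indicator B x) \<in> borel_measurable (lebesgue_on \<Omega>)" if "B \<in> {A, C}" for B
      using that A by (intro borel_measurable_times[OF gm bm] borel_measurable_indicator) auto
    ultimately have "(LINT x|lebesgue_on \<Omega>. g x * indicator C x) = (LINT x|lebesgue_on \<Omega>. g x * indicator A x)"
      by (intro integral_cong_AE) auto
    with zero show ?thesis by simp
  qed
  define P where "P = {x \<in> \<Omega>. g x > 0}"
  define Q where "Q = {x \<in> \<Omega>. g x < 0}"
  have sets: "P \<in> sets lebesgue" "Q \<in> sets lebesgue"
  proof -
    have *: "{x \<in> \<Omega>. g x \<in> Y} \<in> sets lebesgue" if "Y \<in> sets borel" for Y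
      using gm that by (simp add: borel_measurable_lebesgue_on_preimage_borel[OF \<Omega>_sets])
    show "P \<in> sets lebesgue" "Q \<in> sets lebesgue"
      using *[of "{0<..}"] *[of "{..<0}"] by (simp_all add: P_def Q_def)
  qed
  have int: "integrable (lebesgue_on \<Omega>) (\<lambda>x. g x * indicator A x)" if "A \<in> sets lebesgue" for A
  proof (rule Bochner_Integration.integrable_bound[OF g])
    show "(\<lambda>x. g x * indicator A x) \<in> borel_measurable (lebesgue_on \<Omega>)"
      using that by (intro borel_measurable_times[OF gm bm] borel_measurable_indicator)
    show "AE x in lebesgue_on \<Omega>. norm (g x * indicator A x) \<le> norm (g x)"
      by (simp add: indicator_def)
  qed
  have "AE x in lebesgue_on \<Omega>. g x * indicator P x = 0"
    using integral_nonneg_eq_0_iff_AE[OF int[OF sets(1)]] set[OF sets(1)]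
    by (auto simp: P_def indicator_def)
  moreover have "AE x in lebesgue_on \<Omega>. - (g x * indicator Q x) = 0"
    using integral_nonneg_eq_0_iff_AE[OF integrable_minus[OF int[OF sets(2)]]] set[OF sets(2)]
    by (auto simp: Q_def indicator_def)
  ultimately show ?thesis
    by (rule AE_mp[OF _ AE_mp]) (auto simp: P_def Q_def indicator_def split: if_splits)
qed

section \<open>Vector fields, their components, and weak gradients\<close>

lemma L2_space_nth:
  fixes G :: "'a::euclidean_space \<Rightarrow> real^'d::finite"
  assumes "G \<in> L2_space \<Omega>" shows "(\<lambda>x. G x $ i) \<in> L2_space \<Omega>"
proof -
  have G: "G \<in> borel_measurable (lebesgue_on \<Omega>)" "integrable (lebesgue_on \<Omega>) (\<lambda>x. (norm (G x))\<^sup>2)"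
    using assms by (auto simp: L2_space_def)
  have m: "(\<lambda>x. G x $ i) \<in> borel_measurable (lebesgue_on \<Omega>)"
    using borel_measurable_inner[OF G(1) borel_measurable_const[of "axis i 1"]] by (simp add: inner_axis)
  have "(G x $ i)\<^sup>2 \<le> (norm (G x))\<^sup>2" for x
    using component_le_norm_cart[of "G x" i] by (metis abs_ge_zero power2_abs power_mono)
  then have "integrable (lebesgue_on \<Omega>) (\<lambda>x. (norm (G x $ i))\<^sup>2)"
    by (intro Bochner_Integration.integrable_bound[OF G(2)]) (use m in auto)
  with m show ?thesis by (simp add: L2_space_def)
qed

lemma L2_space_vec:
  fixes G :: "'a::euclidean_space \<Rightarrow> real^'d::finite"
  assumes "\<And>i. (\<lambda>x. G x $ i) \<in> L2_space \<Omega>" shows "G \<in> L2_space \<Omega>"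
proof -
  have m: "(\<lambda>x. G x $ i) \<in> borel_measurable (lebesgue_on \<Omega>)"
    and n: "integrable (lebesgue_on \<Omega>) (\<lambda>x. (G x $ i)\<^sup>2)" for i
    using assms[of i] by (auto simp: L2_space_def)
  have "G \<in> borel_measurable (lebesgue_on \<Omega>)"
    unfolding borel_measurable_euclidean_space[of G] by (auto simp: Basis_vec_def inner_axis m)
  moreover have "integrable (lebesgue_on \<Omega>) (\<lambda>x. \<Sum>i\<in>UNIV. (G x $ i)\<^sup>2)" using n by simp
  moreover have "(\<Sum>i\<in>UNIV. (v $ i)\<^sup>2) = (norm v)\<^sup>2" for v :: "real^'d"
    by (simp add: power2_norm_eq_inner inner_vec_def flip: power2_eq_square)
  ultimately show ?thesis by (simp add: L2_space_def)
qed

text \<open>On a set of finite measure the constant 1 is square-integrable, and pairing with it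
  gives integrability.\<close>

lemma L2_space_integrable:
  fixes f :: "'a::euclidean_space \<Rightarrow> real"
  assumes "\<Omega> \<in> lmeasurable" "f \<in> L2_space \<Omega>"
  shows "integrable (lebesgue_on \<Omega>) f"
  using L2_inner_integrable[OF assms(2) bounded_L2_space[OF assms(1), of "\<lambda>_. 1" 1]] by auto

text \<open>Both components pair with a test function to minus the pairing of \<open>v\<close> with
  its partial derivative, so their difference annihilates all test functions. The finitely many
  exceptional null sets are then united.\<close>

lemma weak_gradient_unique:
  assumes "open \<Omega>" "\<Omega> \<in> lmeasurable" and G: "is_weak_gradient \<Omega> v G" and H: "is_weak_gradient \<Omega> v H"
  shows "ae_eq \<Omega> G H"
proof -
  have "AE x in lebesgue_on \<Omega>. G x $ i - H x $ i = 0" for i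
  proof (rule fundamental_lemma[OF assms(1)])
    have L2: "(\<lambda>x. G x $ i) \<in> L2_space \<Omega>" "(\<lambda>x. H x $ i) \<in> L2_space \<Omega>"
      using G H by (auto simp: is_weak_gradient_def L2_space_nth)
    then show "integrable (lebesgue_on \<Omega>) (\<lambda>x. G x $ i - H x $ i)"
      using L2_space_integrable[OF assms(2)] by auto
    fix \<psi> assume \<psi>: "\<psi> \<in> test_functions \<Omega>"
    have "L2_inner \<Omega> (\<lambda>x. 1 *\<^sub>R (G x $ i) + (-1) *\<^sub>R (H x $ i)) \<psi> = 0"
      using G H \<psi> unfolding L2_inner_lincomb_left[OF L2 test_functions_L2_space[OF assms(2) \<psi>]]
      by (auto simp: is_weak_gradient_def)
    then show "(LINT x|lebesgue_on \<Omega>. (G x $ i - H x $ i) * \<psi> x) = 0"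
      by (simp add: L2_inner_def)
  qed
  then have "AE x in lebesgue_on \<Omega>. \<forall>i. G x $ i - H x $ i = 0"
    by (simp add: AE_all_countable)
  then show ?thesis by (auto simp: ae_eq_def vec_eq_iff)
qed

lemma is_weak_gradient_weak_grad:
  "v \<in> H1_space \<Omega> \<Longrightarrow> is_weak_gradient \<Omega> v (weak_grad \<Omega> v)"
  unfolding H1_space_def weak_grad_def using someI_ex[of "is_weak_gradient \<Omega> v"] by simp

lemma H1_imp_L2:
  assumes "v \<in> H1_space \<Omega>" shows "v \<in> L2_space \<Omega>" "weak_grad \<Omega> v \<in> L2_space \<Omega>"
  using assms is_weak_gradient_weak_grad[OF assms] by (auto simp: H1_space_def is_weak_gradient_def)

text \<open>Both sides of the defining identity are linear in the function and its gradient;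
  splitting the integrals is justified because test functions and their partial derivatives are
  square-integrable.\<close>

lemma is_weak_gradient_lincomb:
  assumes "\<Omega> \<in> lmeasurable" and v: "v \<in> L2_space \<Omega>" "is_weak_gradient \<Omega> v G"
    and w: "w \<in> L2_space \<Omega>" "is_weak_gradient \<Omega> w H"
  shows "is_weak_gradient \<Omega> (\<lambda>x. a * v x + b * w x) (\<lambda>x. a *\<^sub>R G x + b *\<^sub>R H x)"
proof -
  have "L2_inner \<Omega> (\<lambda>x. a * v x + b * w x) (partial_deriv i \<psi>)
      = - L2_inner \<Omega> (\<lambda>x. (a *\<^sub>R G x + b *\<^sub>R H x) $ i) \<psi>"
    if \<psi>: "\<psi> \<in> test_functions \<Omega>" for \<psi> i
  proof -
    have L2: "(\<lambda>x. G x $ i) \<in> L2_space \<Omega>" "(\<lambda>x. H x $ i) \<in> L2_space \<Omega>"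
      using v w by (auto simp: is_weak_gradient_def L2_space_nth)
    show ?thesis
      using L2_inner_lincomb_left[OF L2 test_functions_L2_space[OF assms(1) \<psi>], of a b]
        L2_inner_lincomb_left[OF v(1) w(1) test_functions_L2_space[OF assms(1) partial_deriv_test_functions[OF \<psi>, of i]], of a b]
        v(2) w(2) \<psi>
      by (simp add: is_weak_gradient_def)
  qed
  with v(2) w(2) show ?thesis by (auto simp: is_weak_gradient_def L2_space_lincomb)
qed

lemma H1_space_lincomb:
  assumes "\<Omega> \<in> lmeasurable" "v \<in> H1_space \<Omega>" "w \<in> H1_space \<Omega>"
  shows "(\<lambda>x. a * v x + b * w x) \<in> H1_space \<Omega>"
  using is_weak_gradient_lincomb[OF assms(1) H1_imp_L2(1)[OF assms(2)] is_weak_gradient_weak_grad[OF assms(2)]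
      H1_imp_L2(1)[OF assms(3)] is_weak_gradient_weak_grad[OF assms(3)], of a b]
    L2_space_lincomb[OF H1_imp_L2(1)[OF assms(2)] H1_imp_L2(1)[OF assms(3)], of a b]
  by (auto simp: H1_space_def)

text \<open>Both functions are weak gradients of the same combination, so uniqueness identifies them
  although \<open>weak_grad\<close> is a choice.\<close>

lemma weak_grad_lincomb:
  assumes "open \<Omega>" "\<Omega> \<in> lmeasurable" "v \<in> H1_space \<Omega>" "w \<in> H1_space \<Omega>"
  shows "ae_eq \<Omega> (\<lambda>x. a *\<^sub>R weak_grad \<Omega> v x + b *\<^sub>R weak_grad \<Omega> w x)
    (weak_grad \<Omega> (\<lambda>x. a * v x + b * w x))"
  using assms
  by (intro weak_gradient_unique[where v="\<lambda>x. a * v x + b * w x"] is_weak_gradient_lincomb is_weak_gradient_weak_grad H1_space_lincomb H1_imp_L2)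

section \<open>The bilinear form of the phase field\<close>

definition energy :: "(real^'d::finite) set \<Rightarrow> real \<Rightarrow> real \<Rightarrow> (real^'d \<Rightarrow> real) \<Rightarrow> (real^'d \<Rightarrow> real) \<Rightarrow> real" where
  "energy \<Omega> Cn s v w = Cn\<^sup>2 * L2_inner \<Omega> (weak_grad \<Omega> v) (weak_grad \<Omega> w) + s * L2_inner \<Omega> v w"

lemma energy_commute: "energy \<Omega> Cn s v w = energy \<Omega> Cn s w v"
  by (simp add: energy_def L2_inner_commute)

lemma Cns_normsq_eq: "Cns_normsq \<Omega> Cn s v = energy \<Omega> Cn s v v"
  by (simp add: Cns_normsq_def energy_def L2_norm_power2)

lemma energy_lincomb_left:
  assumes "open \<Omega>" "\<Omega> \<in> lmeasurable" and v: "v \<in> H1_space \<Omega>" and w: "w \<in> H1_space \<Omega>" and z: "z \<in> H1_space \<Omega>"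
  shows "energy \<Omega> Cn s (\<lambda>x. a * v x + b * w x) z = a * energy \<Omega> Cn s v z + b * energy \<Omega> Cn s w z"
proof -
  note g = H1_imp_L2(2)
  have "L2_inner \<Omega> (weak_grad \<Omega> (\<lambda>x. a * v x + b * w x)) (weak_grad \<Omega> z)
      = L2_inner \<Omega> (\<lambda>x. a *\<^sub>R weak_grad \<Omega> v x + b *\<^sub>R weak_grad \<Omega> w x) (weak_grad \<Omega> z)"
    using assms by (intro L2_inner_cong[symmetric] weak_grad_lincomb L2_space_lincomb g) (auto simp: ae_eq_def fmeasurableD)
  also have "\<dots> = a * L2_inner \<Omega> (weak_grad \<Omega> v) (weak_grad \<Omega> z) + b * L2_inner \<Omega> (weak_grad \<Omega> w) (weak_grad \<Omega> z)"
    by (intro L2_inner_lincomb_left g v w z)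
  finally show ?thesis
    using L2_inner_lincomb_left[OF v[THEN H1_imp_L2(1)] w[THEN H1_imp_L2(1)] z[THEN H1_imp_L2(1)], of a b]
    by (simp add: energy_def algebra_simps)
qed

lemma energy_lincomb_right:
  assumes "open \<Omega>" "\<Omega> \<in> lmeasurable" "v \<in> H1_space \<Omega>" "w \<in> H1_space \<Omega>" "z \<in> H1_space \<Omega>"
  shows "energy \<Omega> Cn s z (\<lambda>x. a * v x + b * w x) = a * energy \<Omega> Cn s z v + b * energy \<Omega> Cn s z w"
  using energy_lincomb_left[OF assms, of Cn s a b] by (simp add: energy_commute)

section \<open>Cell decompositions\<close>

lemma polyhedral_domain_simps:
  assumes "polyhedral_domain \<Omega>"
  shows "open \<Omega>" "bounded \<Omega>" "\<Omega> \<in> lmeasurable" "\<Omega> \<in> sets lebesgue"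
  using assms by (auto simp: polyhedral_domain_def lmeasurable_open)

text \<open>An indexed family instead of a set of sets, so that two decompositions of \<Omega> can
  share one index set. The negligible remainder absorbs the cell boundaries.\<close>

definition ae_partition :: "'a::euclidean_space set \<Rightarrow> 'i set \<Rightarrow> ('i \<Rightarrow> 'a set) \<Rightarrow> bool" where
  "ae_partition \<Omega> I A \<longleftrightarrow> finite I \<and> (\<forall>i\<in>I. A i \<in> sets lebesgue \<and> A i \<subseteq> \<Omega>) \<and>
     disjoint_family_on A I \<and> negligible (\<Omega> - \<Union>(A ` I))"

text \<open>Off the remainder exactly one cell contains a given point of \<Omega>. Writing the sum
  with indicators turns integrals over different sets into integrals over the whole space.\<close>

lemma ae_partition_sum:
  fixes h :: "'a::euclidean_space \<Rightarrow> 'b::euclidean_space"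
  assumes "ae_partition \<Omega> I A"
  shows "AE x in lebesgue. (\<Sum>i\<in>I. indicator (A i) x *\<^sub>R h x) = indicator \<Omega> x *\<^sub>R h x"
proof -
  have "AE x in lebesgue. x \<notin> \<Omega> - \<Union>(A ` I)"
    using assms by (intro AE_not_in) (simp add: ae_partition_def negligible_iff_null_sets)
  moreover have "(\<Sum>i\<in>I. indicator (A i) x *\<^sub>R h x) = indicator \<Omega> x *\<^sub>R h x"
    if "x \<notin> \<Omega> - \<Union>(A ` I)" for x
  proof -
    have "(\<Sum>i\<in>I. indicator (A i) x *\<^sub>R h x) = indicator (\<Union>(A ` I)) x *\<^sub>R h x"
      using assms by (subst indicator_UN_disjoint) (auto simp: ae_partition_def scaleR_left.sum)
    also have "indicat_real (\<Union>(A ` I)) x = indicator \<Omega> x"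
      using assms that by (auto simp: ae_partition_def indicator_def)
    finally show ?thesis .
  qed
  ultimately show ?thesis by (auto elim: AE_mp)
qed

lemma ae_partition_measurable:
  fixes h :: "'a::euclidean_space \<Rightarrow> 'b::euclidean_space"
  assumes P: "ae_partition \<Omega> I A" and \<Omega>: "\<Omega> \<in> sets lebesgue"
    and h: "\<And>i. i \<in> I \<Longrightarrow> h \<in> borel_measurable (lebesgue_on (A i))"
  shows "h \<in> borel_measurable (lebesgue_on \<Omega>)"
proof -
  have "(\<lambda>x. \<Sum>i\<in>I. indicator (A i) x *\<^sub>R h x) \<in> borel_measurable lebesgue"
    using P h by (intro borel_measurable_sum)
      (auto simp: ae_partition_def indicator_scaleR_eq_if borel_measurable_if)
  from borel_measurable_AE[OF this ae_partition_sum[OF P]] show ?thesis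
    using \<Omega> by (simp add: indicator_scaleR_eq_if borel_measurable_if)
qed

text \<open>Integrability over \<Omega> is a conclusion here: the transferred history is first known
  only on single cells, and the finite sum of cell integrals assembles it.\<close>

lemma ae_partition_integral:
  fixes h :: "'a::euclidean_space \<Rightarrow> 'b::euclidean_space"
  assumes P: "ae_partition \<Omega> I A" and \<Omega>: "\<Omega> \<in> sets lebesgue"
    and h: "\<And>i. i \<in> I \<Longrightarrow> integrable (lebesgue_on (A i)) h"
  shows "integrable (lebesgue_on \<Omega>) h"
    "(LINT x|lebesgue_on \<Omega>. h x) = (\<Sum>i\<in>I. (LINT x|lebesgue_on (A i). h x))"
proof -
  have A: "A i \<inter> space lebesgue \<in> sets lebesgue" if "i \<in> I" for i
    using P that by (simp add: ae_partition_def)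
  have \<Omega>': "\<Omega> \<inter> space lebesgue \<in> sets lebesgue" using \<Omega> by simp
  have "h \<in> borel_measurable (lebesgue_on \<Omega>)"
    by (intro ae_partition_measurable[OF P \<Omega>] borel_measurable_integrable h)
  then have m: "(\<lambda>x. indicator \<Omega> x *\<^sub>R h x) \<in> borel_measurable lebesgue"
    using \<Omega> by (simp add: indicator_scaleR_eq_if borel_measurable_if)
  have int: "integrable lebesgue (\<lambda>x. indicator (A i) x *\<^sub>R h x)" if "i \<in> I" for i
    using h[OF that] integrable_restrict_space[OF A[OF that], of h] by simp
  then have s: "integrable lebesgue (\<lambda>x. \<Sum>i\<in>I. indicator (A i) x *\<^sub>R h x)" by simp
  have "integrable lebesgue (\<lambda>x. indicator \<Omega> x *\<^sub>R h x)"
    by (rule integrable_cong_AE_imp[OF s m ae_partition_sum[OF P]])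
  then show "integrable (lebesgue_on \<Omega>) h"
    using integrable_restrict_space[OF \<Omega>', of h] by simp
  have "(LINT x|lebesgue_on \<Omega>. h x) = (LINT x|lebesgue. indicator \<Omega> x *\<^sub>R h x)"
    by (rule integral_restrict_space[OF \<Omega>'])
  also have "\<dots> = (LINT x|lebesgue. (\<Sum>i\<in>I. indicator (A i) x *\<^sub>R h x))"
    by (rule integral_cong_AE[OF borel_measurable_integrable[OF s] m ae_partition_sum[OF P], symmetric])
  also have "\<dots> = (\<Sum>i\<in>I. (LINT x|lebesgue. indicator (A i) x *\<^sub>R h x))"
    using int by (rule Bochner_Integration.integral_sum)
  also have "\<dots> = (\<Sum>i\<in>I. (LINT x|lebesgue_on (A i). h x))"
    by (intro sum.cong refl integral_restrict_space[OF A, symmetric])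
  finally show "(LINT x|lebesgue_on \<Omega>. h x) = (\<Sum>i\<in>I. (LINT x|lebesgue_on (A i). h x))" .
qed

lemma L2_space_subset:
  fixes f :: "'a::euclidean_space \<Rightarrow> 'b::euclidean_space"
  assumes "f \<in> L2_space \<Omega>" "A \<subseteq> \<Omega>" "A \<in> sets lebesgue" "\<Omega> \<in> sets lebesgue"
  shows "f \<in> L2_space A"
proof -
  have f: "f \<in> borel_measurable (lebesgue_on \<Omega>)" "integrable (lebesgue_on \<Omega>) (\<lambda>x. (norm (f x))\<^sup>2)"
    using assms by (auto simp: L2_space_def)
  have "set_integrable lebesgue \<Omega> (\<lambda>x. (norm (f x))\<^sup>2)"
    using f(2) integrable_restrict_space[of \<Omega> lebesgue "\<lambda>x. (norm (f x))\<^sup>2"] assms(4)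
    by (simp add: set_integrable_def)
  then have "set_integrable lebesgue A (\<lambda>x. (norm (f x))\<^sup>2)"
    using assms by (rule_tac set_integrable_subset)
  then have "integrable (lebesgue_on A) (\<lambda>x. (norm (f x))\<^sup>2)"
    using integrable_restrict_space[of A lebesgue "\<lambda>x. (norm (f x))\<^sup>2"] assms(3)
    by (simp add: set_integrable_def)
  moreover have "f \<in> borel_measurable (lebesgue_on A)"
    using f(1) assms(2) by (rule measurable_restrict_mono)
  ultimately show ?thesis by (simp add: L2_space_def)
qed

lemma ae_partition_L2_space:
  fixes f :: "'a::euclidean_space \<Rightarrow> 'b::euclidean_space"
  assumes "ae_partition \<Omega> I A" "\<Omega> \<in> sets lebesgue" "\<And>i. i \<in> I \<Longrightarrow> f \<in> L2_space (A i)"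
  shows "f \<in> L2_space \<Omega>"
proof -
  have "f \<in> borel_measurable (lebesgue_on \<Omega>)"
    using assms(3) by (intro ae_partition_measurable[OF assms(1,2)]) (simp add: L2_space_def)
  moreover have "integrable (lebesgue_on \<Omega>) (\<lambda>x. (norm (f x))\<^sup>2)"
    using assms(3) by (intro ae_partition_integral(1)[OF assms(1,2)]) (simp add: L2_space_def)
  ultimately show ?thesis by (simp add: L2_space_def)
qed

lemma ae_partition_L2_inner:
  fixes f g :: "'a::euclidean_space \<Rightarrow> 'b::euclidean_space"
  assumes "ae_partition \<Omega> I A" "\<Omega> \<in> sets lebesgue" "f \<in> L2_space \<Omega>" "g \<in> L2_space \<Omega>"
  shows "L2_inner \<Omega> f g = (\<Sum>i\<in>I. L2_inner (A i) f g)"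
  unfolding L2_inner_def
proof (rule ae_partition_integral(2)[OF assms(1,2)])
  fix i assume "i \<in> I"
  then have "A i \<subseteq> \<Omega>" "A i \<in> sets lebesgue" using assms(1) by (auto simp: ae_partition_def)
  then show "integrable (lebesgue_on (A i)) (\<lambda>x. f x \<bullet> g x)"
    by (intro L2_inner_integrable L2_space_subset[OF assms(3) _ _ assms(2)] L2_space_subset[OF assms(4) _ _ assms(2)])
qed

section \<open>Simplicial cells and their images under mesh maps\<close>

lemma simplex_convex_closed:
  assumes "n simplex K" shows "convex K" "closed K" "bounded K"
  using simplex_imp_polytope[OF assms]
  by (auto simp: polytope_imp_convex polytope_imp_closed polytope_imp_bounded)

text \<open>The intersection of two distinct cells is a proper face of at least one of them, and a
  proper face misses the interior.\<close>

lemma conforming_triangulation_disjoint: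
  assumes "conforming_triangulation \<Omega> T"
  shows "disjoint_family_on interior T"
proof (unfold disjoint_family_on_def, intro ballI impI)
  fix K L assume KL: "K \<in> T" "L \<in> T" "K \<noteq> L"
  have face: "K \<inter> L face_of K" "L \<inter> K face_of L"
    using assms KL by (auto simp: conforming_triangulation_def triangulation_def)
  consider "K \<inter> L \<noteq> K" | "L \<inter> K \<noteq> L" using KL(3) by blast
  then show "interior K \<inter> interior L = {}"
  proof cases
    case 1
    with face_of_disjoint_interior[OF face(1)] show ?thesis using interior_subset by blast
  next
    case 2
    with face_of_disjoint_interior[OF face(2)] show ?thesis using interior_subset by blast
  qed
qed

text \<open>What the open cells leave out lies in finitely many boundaries of convex sets, each of
  measure zero.\<close>

lemma conforming_triangulation_ae_partition:
  assumes "conforming_triangulation \<Omega> T"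
  shows "ae_partition \<Omega> T interior"
proof -
  have T: "finite T" "\<Union>T = closure \<Omega>" "\<And>K. K \<in> T \<Longrightarrow> interior K \<subseteq> \<Omega>"
    "\<And>K. K \<in> T \<Longrightarrow> int DIM('a) simplex K"
    using assms by (auto simp: conforming_triangulation_def triangulation_def)
  have "negligible (\<Union>(frontier ` T))"
    using T(1,4) by (intro negligible_Union) (auto intro: negligible_convex_frontier simplex_convex_closed)
  moreover have "\<Omega> - \<Union>(interior ` T) \<subseteq> \<Union>(frontier ` T)"
  proof
    fix x assume x: "x \<in> \<Omega> - \<Union>(interior ` T)"
    then obtain K where "K \<in> T" "x \<in> K" using closure_subset[of \<Omega>] T(2) by blast
    with x show "x \<in> \<Union>(frontier ` T)" using closure_subset[of K] by (auto simp: frontier_def)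
  qed
  ultimately have "negligible (\<Omega> - \<Union>(interior ` T))" by (rule negligible_subset)
  with T conforming_triangulation_disjoint[OF assms] show ?thesis by (auto simp: ae_partition_def)
qed

text \<open>Indexing by the reference cells \<open>Tr\<close> lets the decompositions induced by the
  old and the new mesh map be compared term by term. Injectivity of \<open>X\<close> preserves
  disjointness, and the image cells together are the open cells of \<open>T\<close>.\<close>

lemma mesh_map_ae_partition:
  assumes r: "conforming_triangulation \<Omega>r Tr" and t: "conforming_triangulation \<Omega> T"
    and X: "mesh_map \<Omega>r Tr \<Omega> T X"
  shows "ae_partition \<Omega> Tr (\<lambda>K. X ` interior K)"
proof -
  have img: "(\<lambda>K. X ` interior K) ` Tr = interior ` T" and bij: "bij_betw X \<Omega>r \<Omega>"
    using X by (auto simp: mesh_map_def)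
  have R: "finite Tr" "\<And>K. K \<in> Tr \<Longrightarrow> interior K \<subseteq> \<Omega>r"
    using r by (auto simp: conforming_triangulation_def triangulation_def)
  have "disjoint_family_on (\<lambda>K. X ` interior K) Tr"
    unfolding disjoint_family_on_def
  proof (intro ballI impI)
    fix K L assume KL: "K \<in> Tr" "L \<in> Tr" "K \<noteq> L"
    have "X ` interior K \<inter> X ` interior L = X ` (interior K \<inter> interior L)"
      using inj_on_image_Int[OF bij_betw_imp_inj_on[OF bij] R(2)[OF KL(1)] R(2)[OF KL(2)]] by simp
    then show "X ` interior K \<inter> X ` interior L = {}"
      using conforming_triangulation_disjoint[OF r] KL by (simp add: disjoint_family_on_def)
  qed
  moreover have "X ` interior K \<in> sets lebesgue \<and> X ` interior K \<subseteq> \<Omega>" if "K \<in> Tr" for K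
  proof -
    have "X ` interior K \<in> interior ` T" using img that by blast
    then show ?thesis
      using conforming_triangulation_ae_partition[OF t] by (auto simp: ae_partition_def)
  qed
  ultimately show ?thesis
    using R(1) conforming_triangulation_ae_partition[OF t] by (auto simp: ae_partition_def img)
qed

text \<open>A polynomial is bounded on a compact cell, and finitely many open cells fill \<Omega> up
  to a null set. This supplies the square-integrability of projected histories.\<close>

lemma piecewise_polynomial_L2_space:
  fixes v :: "'a::euclidean_space \<Rightarrow> 'b::euclidean_space"
  assumes T: "conforming_triangulation \<Omega> T" and \<Omega>: "\<Omega> \<in> sets lebesgue" and v: "piecewise_polynomial T v"
  shows "v \<in> L2_space \<Omega>"
proof (rule ae_partition_L2_space[OF conforming_triangulation_ae_partition[OF T] \<Omega>])
  fix K assume K: "K \<in> T"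
  then obtain p where p: "polynomial_function p" "\<And>x. x \<in> interior K \<Longrightarrow> v x = p x"
    using v by (auto simp: piecewise_polynomial_def)
  have "int DIM('a) simplex K" using T K by (auto simp: conforming_triangulation_def)
  then have K': "closed K" "bounded K" using simplex_convex_closed by auto
  have "bounded (p ` K)"
    using K' p(1) by (intro compact_imp_bounded compact_continuous_image)
      (auto simp: continuous_on_polymonial_function compact_eq_bounded_closed)
  then obtain B where B: "\<And>x. x \<in> K \<Longrightarrow> norm (p x) \<le> B" by (auto simp: bounded_iff)
  show "v \<in> L2_space (interior K)"
  proof (rule bounded_L2_space)
    show "interior K \<in> lmeasurable" using K' by (intro lmeasurable_open) (auto simp: bounded_interior)
    have "p \<in> borel_measurable (lebesgue_on (interior K))"
      using borel_measurable_continuous_onI[OF continuous_on_polymonial_function[OF p(1)]]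
      by (intro measurable_restrict_space1 measurable_completion) auto
    then show "v \<in> borel_measurable (lebesgue_on (interior K))"
      by (subst measurable_lebesgue_cong[where g=p]) (auto simp: p(2))
    show "AE x in lebesgue_on (interior K). norm (v x) \<le> B"
      using B p(2) interior_subset[of K] by (intro AE_I2) auto
  qed
qed

section \<open>Kinetic transfers\<close>

text \<open>A preimage under \<open>p\<close> is an image under its inverse \<open>q\<close>, and
  differentiable maps send Lebesgue sets to Lebesgue sets. Continuity of \<open>p\<close> alone
  would not make the composition with a Lebesgue measurable \<open>f\<close> measurable.\<close>

lemma measurable_compose_inverse:
  fixes p q :: "'a::euclidean_space \<Rightarrow> 'a" and f :: "'a \<Rightarrow> 'b::euclidean_space"
  assumes A: "A \<in> sets lebesgue" and B: "B \<in> sets lebesgue"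
    and f: "f \<in> borel_measurable (lebesgue_on A)" and q: "q differentiable_on A"
    and pq: "\<And>x. x \<in> B \<Longrightarrow> p x \<in> A" "\<And>x. x \<in> B \<Longrightarrow> q (p x) = x"
      "\<And>y. y \<in> A \<Longrightarrow> q y \<in> B" "\<And>y. y \<in> A \<Longrightarrow> p (q y) = y"
  shows "(\<lambda>x. f (p x)) \<in> borel_measurable (lebesgue_on B)"
  unfolding borel_measurable_lebesgue_on_preimage_borel[OF B]
proof (intro allI impI)
  fix Y :: "'b set" assume "Y \<in> sets borel"
  then have Y: "{y \<in> A. f y \<in> Y} \<in> sets lebesgue"
    using f by (simp add: borel_measurable_lebesgue_on_preimage_borel[OF A])
  have "{x \<in> B. f (p x) \<in> Y} = q ` {y \<in> A. f y \<in> Y}"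
  proof
    show "{x \<in> B. f (p x) \<in> Y} \<subseteq> q ` {y \<in> A. f y \<in> Y}"
    proof
      fix x assume "x \<in> {x \<in> B. f (p x) \<in> Y}"
      then show "x \<in> q ` {y \<in> A. f y \<in> Y}"
        using pq(1,2)[of x] by (intro image_eqI[of _ _ "p x"]) auto
    qed
  qed (use pq in auto)
  also have "\<dots> \<in> sets lebesgue"
    using q by (intro differentiable_image_in_sets_lebesgue[OF Y]) (auto intro: differentiable_on_subset)
  finally show "{x \<in> B. f (p x) \<in> Y} \<in> sets lebesgue" .
qed

text \<open>Restates the change of variables for absolutely integrable functions in terms of
  \<open>lebesgue_on\<close>. The sort \<open>wellorder\<close> is inherited from that
  theorem.\<close>

lemma lebesgue_on_change_of_variables:
  fixes f :: "real^'m::{finite,wellorder} \<Rightarrow> real" and g :: "real^'m::_ \<Rightarrow> real^'m::_"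
  assumes S: "S \<in> sets lebesgue"
    and der: "\<And>x. x \<in> S \<Longrightarrow> (g has_derivative g' x) (at x within S)"
    and inj: "inj_on g S"
  shows "integrable (lebesgue_on (g ` S)) f \<longleftrightarrow>
      integrable (lebesgue_on S) (\<lambda>x. \<bar>det (matrix (g' x))\<bar> * f (g x))" (is "?L \<longleftrightarrow> ?R")
    and "integrable (lebesgue_on (g ` S)) f \<Longrightarrow>
      (LINT y|lebesgue_on (g ` S). f y) = (LINT x|lebesgue_on S. \<bar>det (matrix (g' x))\<bar> * f (g x))"
proof -
  have gS: "g ` S \<in> sets lebesgue"
    using der by (intro differentiable_image_in_sets_lebesgue[OF S])
      (auto simp: differentiable_on_def differentiable_def)
  have ai: "integrable (lebesgue_on A) h \<longleftrightarrow> h absolutely_integrable_on A"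
    if "A \<in> sets lebesgue" for A and h :: "real^'m::_ \<Rightarrow> real"
    using integrable_restrict_space[of A lebesgue h] that by (simp add: set_integrable_def)
  have eq: "(LINT x|lebesgue_on A. h x) = integral A h"
    if "A \<in> sets lebesgue" "integrable (lebesgue_on A) h" for A and h :: "real^'m::_ \<Rightarrow> real"
    using has_integral_integral_lebesgue_on[OF that(2,1)] by (simp add: has_integral_iff)
  \<comment> \<open>The underlying theorem concerns vector-valued functions, so \<open>f\<close> is
    embedded in \<open>real^1\<close>. Keeping the value \<open>b\<close> free yields both the
    equivalence of integrability and the equality of the integrals.\<close>
  have cov: "((\<lambda>x. \<bar>det (matrix (g' x))\<bar> * f (g x)) absolutely_integrable_on S \<and>
      integral S (\<lambda>x. \<bar>det (matrix (g' x))\<bar> * f (g x)) = b)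
    \<longleftrightarrow> (f absolutely_integrable_on (g ` S) \<and> integral (g ` S) f = b)" for b
    using has_absolute_integral_change_of_variables[OF S der inj, of "\<lambda>x. vec (f x) :: real^1" "vec b"]
    by (simp add: absolutely_integrable_on_1_iff integral_on_1_eq)
  show iff: "?L \<longleftrightarrow> ?R" using cov unfolding ai[OF S] ai[OF gS] by blast
  show "(LINT y|lebesgue_on (g ` S). f y) = (LINT x|lebesgue_on S. \<bar>det (matrix (g' x))\<bar> * f (g x))"
    if ?L
    using that cov iff unfolding eq[OF gS that] eq[OF S iff[THEN iffD1, OF that]] ai[OF S] ai[OF gS] by blast
qed

text \<open>Pulled back to the reference cell \<open>U\<close>, the squared norms of
  \<open>g\<close> and \<open>g'\<close>, each times its own Jacobian determinant, are the same
  function: the half powers square to exactly the ratio of the determinants.\<close>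

lemma L2_cell_transfer:
  fixes X X' :: "real^'d::{finite,wellorder} \<Rightarrow> real^'d::_" and g g' :: "real^'d::_ \<Rightarrow> real^'d::_"
  assumes U: "U \<in> sets lebesgue"
    and X: "\<And>x. x \<in> U \<Longrightarrow> X differentiable (at x)" "\<And>x. x \<in> U \<Longrightarrow> jac_det X x > 0"
    and X': "\<And>x. x \<in> U \<Longrightarrow> X' differentiable (at x)" "\<And>x. x \<in> U \<Longrightarrow> jac_det X' x > 0"
    and Y: "\<And>x. x \<in> U \<Longrightarrow> Y (X x) = x" "\<And>y. y \<in> X ` U \<Longrightarrow> Y differentiable (at y)"
    and Y': "\<And>x. x \<in> U \<Longrightarrow> Y' (X' x) = x"
    and g: "g \<in> L2_space (X ` U)"
    and g': "\<And>x. x \<in> U \<Longrightarrow> g' (X' x) = (jac_det X' x powr (-1/2) * jac_det X x powr (1/2)) *\<^sub>R g (X x)"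
  shows "g' \<in> L2_space (X' ` U)" "L2_inner (X' ` U) g' g' = L2_inner (X ` U) g g"
proof -
  have der: "(Z has_derivative frechet_derivative Z (at x)) (at x within U)"
    if "Z differentiable (at x)" for Z :: "real^'d::_ \<Rightarrow> real^'d::_" and x
    using that by (simp add: frechet_derivative_works has_derivative_at_withinI)
  note dX = der[OF X(1)] and dX' = der[OF X'(1)]
  have inj: "inj_on X U" "inj_on X' U" using Y(1) Y' by (auto intro: inj_on_inverseI)
  have diff: "X differentiable_on U" "X' differentiable_on U"
    using dX dX' by (auto simp: differentiable_on_def differentiable_def)
  have img: "X ` U \<in> sets lebesgue" "X' ` U \<in> sets lebesgue"
    using differentiable_image_in_sets_lebesgue[OF U order_refl] diff by auto
  have jm: "jac_det Z \<in> borel_measurable (lebesgue_on U)"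
    if "\<And>x. x \<in> U \<Longrightarrow> Z differentiable (at x)" for Z :: "real^'d::_ \<Rightarrow> real^'d::_"
    using borel_measurable_det_Jacobian[OF U der[OF that]] by (simp add: jac_det_def[abs_def] jacobian_def)
  have gm: "g \<in> borel_measurable (lebesgue_on (X ` U))" using g by (simp add: L2_space_def)
  \<comment> \<open>Since \<open>g\<close> is only Lebesgue measurable, measurability of
    \<open>g (X x)\<close> comes from differentiability of the inverse \<open>Y\<close>; for
    \<open>F (Y' y)\<close> below the differentiable inverse is \<open>X'\<close>.\<close>
  have "Y differentiable_on X ` U"
    using Y(2) by (auto simp: differentiable_on_def intro: differentiable_at_withinI)
  then have gX: "(\<lambda>x. g (X x)) \<in> borel_measurable (lebesgue_on U)"
    by (rule measurable_compose_inverse[OF img(1) U gm]) (use Y(1) in auto)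
  define F where "F x = (jac_det X' x powr (-1/2) * jac_det X x powr (1/2)) *\<^sub>R g (X x)" for x
  have "F \<in> borel_measurable (lebesgue_on U)"
    unfolding F_def[abs_def] using jm[OF X(1)] jm[OF X'(1)] gX
    by measurable
  then have "(\<lambda>y. F (Y' y)) \<in> borel_measurable (lebesgue_on (X' ` U))"
    by (rule measurable_compose_inverse[OF U img(2) _ diff(2)]) (use Y' in auto)
  then have g'm: "g' \<in> borel_measurable (lebesgue_on (X' ` U))"
    by (subst measurable_lebesgue_cong[where g="\<lambda>y. F (Y' y)"]) (auto simp: g' F_def Y')
  have norm_eq: "\<bar>det (matrix (frechet_derivative X' (at x)))\<bar> * (norm (g' (X' x)))\<^sup>2
      = \<bar>det (matrix (frechet_derivative X (at x)))\<bar> * (norm (g (X x)))\<^sup>2" if "x \<in> U" for x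
  proof -
    have pos: "jac_det X x > 0" "jac_det X' x > 0" using X X' that by auto
    have "(norm (g' (X' x)))\<^sup>2 = (jac_det X' x powr (-1/2))\<^sup>2 * (jac_det X x powr (1/2))\<^sup>2 * (norm (g (X x)))\<^sup>2"
      using g'[OF that] by (simp add: power_mult_distrib)
    also have "(jac_det X x powr (1/2))\<^sup>2 = jac_det X x"
      using pos by (simp add: powr_half_sqrt)
    also have "(jac_det X' x powr (-1/2))\<^sup>2 = inverse (jac_det X' x)"
      using pos by (simp add: powr_minus powr_half_sqrt power_inverse)
    finally have "jac_det X' x * (norm (g' (X' x)))\<^sup>2 = jac_det X x * (norm (g (X x)))\<^sup>2"
      using pos by simp
    with pos show ?thesis by (simp add: jac_det_def jacobian_def)
  qed
  have gi: "integrable (lebesgue_on (X ` U)) (\<lambda>y. (norm (g y))\<^sup>2)" using g by (simp add: L2_space_def)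
  have cong: "integrable (lebesgue_on U) (\<lambda>x. \<bar>det (matrix (frechet_derivative X' (at x)))\<bar> * (norm (g' (X' x)))\<^sup>2)
      \<longleftrightarrow> integrable (lebesgue_on U) (\<lambda>x. \<bar>det (matrix (frechet_derivative X (at x)))\<bar> * (norm (g (X x)))\<^sup>2)"
    by (rule Bochner_Integration.integrable_cong) (auto simp: norm_eq)
  \<comment> \<open>Integrability passes from \<open>X\<close>
    U\<open>through\<close>U\<open>to\<close>X' \<open>U\<close> before any values are compared,
    because the integral formula presupposes it.\<close>
  have g'i: "integrable (lebesgue_on (X' ` U)) (\<lambda>y. (norm (g' y))\<^sup>2)"
    using gi cong lebesgue_on_change_of_variables(1)[OF U dX inj(1), of "\<lambda>y. (norm (g y))\<^sup>2"]
      lebesgue_on_change_of_variables(1)[OF U dX' inj(2), of "\<lambda>y. (norm (g' y))\<^sup>2"] by simp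
  with g'm show "g' \<in> L2_space (X' ` U)" by (simp add: L2_space_def)
  have "(LINT y|lebesgue_on (X' ` U). (norm (g' y))\<^sup>2) = (LINT y|lebesgue_on (X ` U). (norm (g y))\<^sup>2)"
    using lebesgue_on_change_of_variables(2)[OF U dX inj(1) gi]
      lebesgue_on_change_of_variables(2)[OF U dX' inj(2) g'i]
      Bochner_Integration.integral_cong[OF refl norm_eq, of "lebesgue_on U"] by simp
  then show "L2_inner (X' ` U) g' g' = L2_inner (X ` U) g g"
    by (simp add: L2_inner_def dot_square_norm)
qed

text \<open>The image cells X(K) and X'(K) generally differ, but their contributions to the norms
  agree for each reference cell K, and both families exhaust \<Omega> up to a null set.\<close>

lemma fixed_topology_transfer_isometry:
  fixes \<Omega> :: "(real^'d::{finite,wellorder}) set" and g g' :: "nat \<Rightarrow> real^'d::_ \<Rightarrow> real^'d::_"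
  assumes \<Omega>: "\<Omega> \<in> sets lebesgue" and T: "conforming_triangulation \<Omega> T" "conforming_triangulation \<Omega> T'"
    and tr: "fixed_topology_transfer \<Omega> T T' J g g'" and j: "j \<in> J" and g: "g j \<in> L2_space \<Omega>"
  shows "g' j \<in> L2_space \<Omega> \<and> L2_norm \<Omega> (g' j) = L2_norm \<Omega> (g j)"
proof -
  obtain \<Omega>r Tr X X' where r: "conforming_triangulation \<Omega>r Tr"
    and X: "mesh_map \<Omega>r Tr \<Omega> T X" and X': "mesh_map \<Omega>r Tr \<Omega> T' X'"
    and g': "ae_eq \<Omega> (g' j) ((\<lambda>\<xi>. (jac_det X' \<xi> powr (-1/2) * jac_det X \<xi> powr (1/2)) *\<^sub>R g j (X \<xi>))
             \<circ> inv_into \<Omega>r X')"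
    using tr j unfolding fixed_topology_transfer_def by blast
  \<comment> \<open>\<open>g' j\<close> is known only almost everywhere; \<open>h\<close> satisfies
    the transfer formula at every point of the image cells, as the cell lemma demands, and is
    exchanged for \<open>g' j\<close> at the end.\<close>
  define h where "h = (\<lambda>\<xi>. (jac_det X' \<xi> powr (-1/2) * jac_det X \<xi> powr (1/2)) *\<^sub>R g j (X \<xi>))
             \<circ> inv_into \<Omega>r X'"
  note P = mesh_map_ae_partition[OF r T(1) X] and P' = mesh_map_ae_partition[OF r T(2) X']
  have cell: "h \<in> L2_space (X' ` interior K)"
      "L2_inner (X' ` interior K) h h = L2_inner (X ` interior K) (g j) (g j)" if K: "K \<in> Tr" for K
  proof -
    have Kr: "interior K \<subseteq> \<Omega>r" using r K by (simp add: conforming_triangulation_def)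
    have bij: "inj_on X \<Omega>r" "inj_on X' \<Omega>r"
      using X X' by (auto simp: mesh_map_def bij_betw_def)
    \<comment> \<open>Differentiability of the inverse is prescribed on cells of \<open>T\<close>,
      so the image of the reference cell has to be recognised as one of them.\<close>
    obtain L where L: "L \<in> T" "X ` interior K = interior L"
    proof -
      have "X ` interior K \<in> interior ` T"
        using X imageI[OF K, of "\<lambda>K. X ` interior K"] by (simp add: mesh_map_def)
      then show thesis using that by blast
    qed
    have "X ` interior K \<subseteq> \<Omega>" "X ` interior K \<in> sets lebesgue"
      using P K by (auto simp: ae_partition_def)
    then have gK: "g j \<in> L2_space (X ` interior K)" by (rule L2_space_subset[OF g _ _ \<Omega>])
    have U: "interior K \<in> sets lebesgue" by simp
    have dX: "X differentiable (at x)" "X' differentiable (at x)" "jac_det X x > 0" "jac_det X' x > 0"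
      if "x \<in> interior K" for x
      using X X' K that by (auto simp: mesh_map_def C1_map_on_def)
    have inv: "inv_into \<Omega>r X (X x) = x" "inv_into \<Omega>r X' (X' x) = x" if "x \<in> interior K" for x
      using that Kr bij by (auto intro!: inv_into_f_f)
    have dY: "inv_into \<Omega>r X differentiable (at y)" if "y \<in> X ` interior K" for y
      using X L that by (auto simp: mesh_map_def C1_map_on_def)
    have h: "h (X' x) = (jac_det X' x powr (-1/2) * jac_det X x powr (1/2)) *\<^sub>R g j (X x)"
      if "x \<in> interior K" for x using inv(2)[OF that] by (simp add: h_def)
    note * = L2_cell_transfer[OF U dX(1) dX(3) dX(2) dX(4) inv(1) dY inv(2) gK h]
    show "h \<in> L2_space (X' ` interior K)" by (rule *(1))
    show "L2_inner (X' ` interior K) h h = L2_inner (X ` interior K) (g j) (g j)" by (rule *(2))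
  qed
  have hL2: "h \<in> L2_space \<Omega>" by (rule ae_partition_L2_space[OF P' \<Omega> cell(1)])
  have "L2_inner \<Omega> h h = L2_inner \<Omega> (g j) (g j)"
    unfolding ae_partition_L2_inner[OF P' \<Omega> hL2 hL2] ae_partition_L2_inner[OF P \<Omega> g g]
    using cell(2) by simp
  moreover have hg': "ae_eq \<Omega> h (g' j)" using g' unfolding h_def by (rule ae_eq_sym)
  ultimately show ?thesis
    using L2_space_ae_eq[OF \<Omega> hL2 hg'] L2_norm_cong[OF \<Omega> hL2 hg'] by (simp add: L2_norm_def)
qed

lemma topology_change_transfer_isometry:
  fixes \<Omega> :: "(real^'d::finite) set" and g g' :: "nat \<Rightarrow> real^'d \<Rightarrow> real^'d"
  assumes \<Omega>: "\<Omega> \<in> sets lebesgue" and T': "conforming_triangulation \<Omega> T'"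
    and tr: "topology_change_transfer \<Omega> T' J g g'" and j: "j \<in> J" and g: "g j \<in> L2_space \<Omega>"
  shows "g' j \<in> L2_space \<Omega> \<and> L2_norm \<Omega> (g' j) = L2_norm \<Omega> (g j)"
proof -
  obtain W P where W: "piecewise_polynomial_space T' W" and P: "L2_projection \<Omega> W P"
    and nz: "\<not> ae_eq \<Omega> (g j) (\<lambda>_. 0) \<Longrightarrow> \<not> ae_eq \<Omega> (P (g j)) (\<lambda>_. 0)"
    and g': "if ae_eq \<Omega> (g j) (\<lambda>_. 0) then ae_eq \<Omega> (g' j) (\<lambda>_. 0)
               else ae_eq \<Omega> (g' j) (\<lambda>x. (L2_norm \<Omega> (g j) / L2_norm \<Omega> (P (g j))) *\<^sub>R P (g j) x)"
    using tr j unfolding topology_change_transfer_def by blast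
  show ?thesis
  proof (cases "ae_eq \<Omega> (g j) (\<lambda>_. 0)")
    case True
    then have e: "ae_eq \<Omega> (g j) (g' j)" using g' by (auto intro: ae_eq_trans ae_eq_sym)
    show ?thesis using L2_space_ae_eq[OF \<Omega> g e] L2_norm_cong[OF \<Omega> g e] by simp
  next
    case False
    define c where "c = L2_norm \<Omega> (g j) / L2_norm \<Omega> (P (g j))"
    have "P (g j) \<in> W" using P g by (auto simp: L2_projection_def)
    then have Pg: "P (g j) \<in> L2_space \<Omega>"
      using W by (intro piecewise_polynomial_L2_space[OF T' \<Omega>]) (auto simp: piecewise_polynomial_space_def)
    have nz: "L2_norm \<Omega> (P (g j)) \<noteq> 0" using nz[OF False] L2_norm_eq_0[OF Pg] by blast
    \<comment> \<open>The sign allows \<open>c\<close> to be taken out of the norm without an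
      absolute value.\<close>
    have c0: "c \<ge> 0" by (simp add: c_def L2_norm_def L2_inner_def integral_nonneg)
    have cP: "(\<lambda>x. c *\<^sub>R P (g j) x) \<in> L2_space \<Omega>"
      using L2_space_lincomb[OF Pg Pg, of c 0] by simp
    have "ae_eq \<Omega> (g' j) (\<lambda>x. c *\<^sub>R P (g j) x)" using g' False by (simp add: c_def)
    then have e: "ae_eq \<Omega> (\<lambda>x. c *\<^sub>R P (g j) x) (g' j)" by (rule ae_eq_sym)
    have "L2_norm \<Omega> (\<lambda>x. c *\<^sub>R P (g j) x) = c * L2_norm \<Omega> (P (g j))"
      using c0 by (simp add: L2_norm_def L2_inner_def real_sqrt_mult flip: mult.assoc power2_eq_square)
    then show ?thesis
      using L2_space_ae_eq[OF \<Omega> cP e] L2_norm_cong[OF \<Omega> cP e] nz by (simp add: c_def)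
  qed
qed

lemma kinetic_transfer_isometry:
  fixes \<Omega> :: "(real^'d::{finite,wellorder}) set" and g g' :: "nat \<Rightarrow> real^'d::_ \<Rightarrow> real^'d::_"
  assumes "\<Omega> \<in> sets lebesgue" "conforming_triangulation \<Omega> T" "conforming_triangulation \<Omega> T'"
    and "kinetic_transfer \<Omega> T T' J g g'" "j \<in> J" "g j \<in> L2_space \<Omega>"
  shows "g' j \<in> L2_space \<Omega>" "L2_norm \<Omega> (g' j) = L2_norm \<Omega> (g j)"
proof -
  have "g' j \<in> L2_space \<Omega> \<and> L2_norm \<Omega> (g' j) = L2_norm \<Omega> (g j)"
    using assms(4) unfolding kinetic_transfer_def
  proof
    assume "fixed_topology_transfer \<Omega> T T' J g g'"
    from fixed_topology_transfer_isometry[OF assms(1-3) this assms(5)] assms(6) show ?thesis by blast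
  next
    assume "topology_change_transfer \<Omega> T' J g g'"
    from topology_change_transfer_isometry[OF assms(1,3) this assms(5)] assms(6) show ?thesis by blast
  qed
  then show "g' j \<in> L2_space \<Omega>" "L2_norm \<Omega> (g' j) = L2_norm \<Omega> (g j)" by auto
qed

section \<open>The identities\<close>

lemma energy_scaled_diff_right:
  assumes "open \<Omega>" "\<Omega> \<in> lmeasurable" "v \<in> H1_space \<Omega>" "w \<in> H1_space \<Omega>" "z \<in> H1_space \<Omega>"
  shows "energy \<Omega> Cn s z (\<lambda>x. c * (v x - w x)) = c * (energy \<Omega> Cn s z v - energy \<Omega> Cn s z w)"
  using energy_lincomb_right[OF assms, of Cn s c "- c"] by (simp add: algebra_simps)

lemma Cns_normsq_lincomb:
  assumes "open \<Omega>" "\<Omega> \<in> lmeasurable" "v \<in> H1_space \<Omega>" "w \<in> H1_space \<Omega>"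
  shows "Cns_normsq \<Omega> Cn s (\<lambda>x. a * v x + b * w x) =
    a\<^sup>2 * energy \<Omega> Cn s v v + 2 * a * b * energy \<Omega> Cn s v w + b\<^sup>2 * energy \<Omega> Cn s w w"
proof -
  have H: "(\<lambda>x. a * v x + b * w x) \<in> H1_space \<Omega>" using assms by (intro H1_space_lincomb)
  show ?thesis
    unfolding Cns_normsq_eq energy_lincomb_left[OF assms H] energy_lincomb_right[OF assms assms(3)]
      energy_lincomb_right[OF assms assms(4)] energy_commute[of \<Omega> Cn s w v]
    by (simp add: algebra_simps power2_eq_square)
qed

lemma L2_norm_lincomb_power2:
  fixes f g :: "'a::euclidean_space \<Rightarrow> 'b::euclidean_space"
  assumes "f \<in> L2_space S" "g \<in> L2_space S"
  shows "(L2_norm S (\<lambda>x. a *\<^sub>R f x + b *\<^sub>R g x))\<^sup>2 =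
    a\<^sup>2 * L2_inner S f f + 2 * a * b * L2_inner S f g + b\<^sup>2 * L2_inner S g g"
  unfolding L2_norm_power2 L2_inner_lincomb_left[OF assms L2_space_lincomb[OF assms]]
    L2_inner_lincomb_right[OF assms assms(1)] L2_inner_lincomb_right[OF assms assms(2)] L2_inner_commute[of S g f]
  by (simp add: algebra_simps power2_eq_square)

text \<open>Here \<open>w\<close> is the old phase field and \<open>vh\<close> its representative.
  By \<open>rep\<close> the product of \<open>v\<close> with \<open>v - vh\<close> equals that with
  \<open>v - w\<close>, and 2a(a-b) = a^2 - b^2 + (a-b)^2 applies.\<close>

lemma phase_identity_1:
  assumes "open \<Omega>" "\<Omega> \<in> lmeasurable" "\<tau> > 0"
    and H: "v \<in> H1_space \<Omega>" "w \<in> H1_space \<Omega>" "vh \<in> H1_space \<Omega>"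
    and rep: "energy \<Omega> Cn s vh v = energy \<Omega> Cn s w v"
  shows "\<tau> * energy \<Omega> Cn s v (\<lambda>x. 1 / \<tau> * (v x - vh x)) =
    1/2 * (Cns_normsq \<Omega> Cn s v - Cns_normsq \<Omega> Cn s w + Cns_normsq \<Omega> Cn s (\<lambda>x. v x - w x))"
  using energy_scaled_diff_right[OF assms(1,2) H(1,3,1), of Cn s "1 / \<tau>"]
    Cns_normsq_lincomb[OF assms(1,2) H(1,2), of Cn s 1 "-1"] rep assms(3)
    energy_commute[of \<Omega> Cn s v vh] energy_commute[of \<Omega> Cn s v w]
  by (simp add: Cns_normsq_eq)

lemma phase_identity_2:
  assumes \<Omega>: "open \<Omega>" "\<Omega> \<in> lmeasurable" and "\<tau> > 0"
    and H: "v \<in> H1_space \<Omega>" "w \<in> H1_space \<Omega>" "z \<in> H1_space \<Omega>" "vh \<in> H1_space \<Omega>"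
    and rep: "energy \<Omega> Cn s vh v = energy \<Omega> Cn s (\<lambda>x. (4 * w x - z x) / 3) v"
  shows "\<tau> * energy \<Omega> Cn s v (\<lambda>x. (3/2) / \<tau> * (v x - vh x)) =
    1/4 * (Cns_normsq \<Omega> Cn s v + Cns_normsq \<Omega> Cn s (\<lambda>x. 2 * v x - w x)
      - Cns_normsq \<Omega> Cn s w - Cns_normsq \<Omega> Cn s (\<lambda>x. 2 * w x - z x)
      + Cns_normsq \<Omega> Cn s (\<lambda>x. v x - 2 * w x + z x))"
proof -
  define e where "e = energy \<Omega> Cn s"
  have comm: "e w v = e v w" "e z v = e v z" "e z w = e w z" "e vh v = e v vh"
    by (simp_all add: e_def energy_commute)
  \<comment> \<open>The expansion of a norm treats two summands at a time; \<open>q\<close> collects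
    the first two of the second difference, leaving \<open>q + z\<close>.\<close>
  define q where "q = (\<lambda>x. 1 * v x + (-2) * w x)"
  have q: "q \<in> H1_space \<Omega>" unfolding q_def by (intro H1_space_lincomb \<Omega> H)
  have "(\<lambda>x. 4/3 * w x + (-1/3) * z x) = (\<lambda>x. (4 * w x - z x) / 3)" by (auto simp: field_simps)
  then have rep': "3 * e v vh = 4 * e v w - e v z"
    using rep energy_lincomb_left[OF \<Omega> H(2,3,1), of Cn s "4/3" "-1/3"] comm by (simp add: e_def)
  have "\<tau> * e v (\<lambda>x. (3/2) / \<tau> * (v x - vh x)) = 3/2 * (e v v - e v vh)"
    using energy_scaled_diff_right[OF \<Omega> H(1,4,1), of Cn s "(3/2) / \<tau>"] \<open>\<tau> > 0\<close>
    by (simp add: e_def)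
  moreover have "Cns_normsq \<Omega> Cn s (\<lambda>x. 2 * v x - w x) = 4 * e v v - 4 * e v w + e w w"
    using Cns_normsq_lincomb[OF \<Omega> H(1,2), of Cn s 2 "-1"] by (simp add: e_def)
  moreover have "Cns_normsq \<Omega> Cn s (\<lambda>x. 2 * w x - z x) = 4 * e w w - 4 * e w z + e z z"
    using Cns_normsq_lincomb[OF \<Omega> H(2,3), of Cn s 2 "-1"] by (simp add: e_def)
  moreover have "e q q = e v v - 4 * e v w + 4 * e w w"
    using Cns_normsq_lincomb[OF \<Omega> H(1,2), of Cn s 1 "-2"] by (simp add: e_def q_def Cns_normsq_eq)
  moreover have "e q z = e v z - 2 * e w z"
    using energy_lincomb_left[OF \<Omega> H(1,2,3), of Cn s 1 "-2"] by (simp add: e_def q_def)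
  moreover have "Cns_normsq \<Omega> Cn s (\<lambda>x. v x - 2 * w x + z x) = e q q + 2 * e q z + e z z"
    using Cns_normsq_lincomb[OF \<Omega> q H(3), of Cn s 1 1] by (simp add: e_def q_def)
  ultimately show ?thesis
    using rep' unfolding Cns_normsq_eq e_def[symmetric] by (simp add: field_simps)
qed

lemma kinetic_identity_1:
  fixes z a :: "'a::euclidean_space \<Rightarrow> 'b::euclidean_space"
  assumes "z \<in> L2_space S" "a \<in> L2_space S"
  shows "L2_inner S (\<lambda>x. z x - a x) z =
    1/2 * ((L2_norm S z)\<^sup>2 - (L2_norm S a)\<^sup>2 + (L2_norm S (\<lambda>x. z x - a x))\<^sup>2)"
  using L2_inner_lincomb_left[OF assms assms(1), of 1 "-1"] L2_norm_lincomb_power2[OF assms, of 1 "-1"]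
    L2_inner_commute[of S z a]
  by (simp add: L2_norm_power2)

text \<open>Here \<open>a\<close> and \<open>b\<close> are the two transferred histories. If no
  transfer intervened, they would be \<zeta>(n) and 2\<zeta>(n) - \<zeta>(n-1), so that (2a+b)/3 is
  the usual two-step history and z - b the second difference.\<close>

lemma kinetic_identity_2:
  fixes z a b :: "'a::euclidean_space \<Rightarrow> 'b::euclidean_space"
  assumes z: "z \<in> L2_space S" and a: "a \<in> L2_space S" and b: "b \<in> L2_space S"
  shows "3/2 * L2_inner S (\<lambda>x. z x - (1/3) *\<^sub>R (2 *\<^sub>R a x + b x)) z =
    1/4 * ((L2_norm S z)\<^sup>2 + (L2_norm S (\<lambda>x. 2 *\<^sub>R z x - a x))\<^sup>2
      - (L2_norm S a)\<^sup>2 - (L2_norm S b)\<^sup>2 + (L2_norm S (\<lambda>x. z x - b x))\<^sup>2)"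
proof -
  have h: "(\<lambda>x. (2/3) *\<^sub>R a x + (1/3) *\<^sub>R b x) \<in> L2_space S" by (intro L2_space_lincomb a b)
  have eq: "(\<lambda>x. z x - (1/3) *\<^sub>R (2 *\<^sub>R a x + b x)) =
      (\<lambda>x. 1 *\<^sub>R z x + (-1) *\<^sub>R ((2/3) *\<^sub>R a x + (1/3) *\<^sub>R b x))"
    by (simp add: scaleR_add_right algebra_simps)
  have "L2_inner S (\<lambda>x. z x - (1/3) *\<^sub>R (2 *\<^sub>R a x + b x)) z =
      L2_inner S z z - (2/3 * L2_inner S z a + 1/3 * L2_inner S z b)"
    unfolding eq L2_inner_lincomb_left[OF z h z] L2_inner_lincomb_left[OF a b z]
    by (simp add: L2_inner_commute[of S a z] L2_inner_commute[of S b z])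
  moreover have "(L2_norm S (\<lambda>x. 2 *\<^sub>R z x - a x))\<^sup>2 = 4 * L2_inner S z z - 4 * L2_inner S z a + L2_inner S a a"
    using L2_norm_lincomb_power2[OF z a, of 2 "-1"] by simp
  moreover have "(L2_norm S (\<lambda>x. z x - b x))\<^sup>2 = L2_inner S z z - 2 * L2_inner S z b + L2_inner S b b"
    using L2_norm_lincomb_power2[OF z b, of 1 "-1"] by simp
  ultimately show ?thesis by (simp add: L2_norm_power2)
qed

text \<open>The upper density bound gives the majorant C |u|^2, and positivity from the lower bound
  makes the squared root equal to \<rho>. The velocity itself is square-integrable because its
  components lie in \<open>H1_space\<close>.\<close>

lemma density_scaled_L2_space:
  fixes u :: "real^'d::finite \<Rightarrow> real^'d"
  assumes \<Omega>: "\<Omega> \<in> sets lebesgue" and V: "vector_fe_space \<Omega> T V" "u \<in> V" and \<rho>: "admissible_density \<Omega> \<rho>"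
  shows "(\<lambda>x. sqrt (\<rho> x) *\<^sub>R u x) \<in> L2_space \<Omega>"
proof -
  have u: "u \<in> L2_space \<Omega>"
    using V by (intro L2_space_vec H1_imp_L2(1)) (auto simp: vector_fe_space_def)
  obtain c C where c: "0 < c" "AE x in lebesgue_on \<Omega>. c \<le> \<rho> x \<and> \<rho> x \<le> C"
    and m: "\<rho> \<in> borel_measurable (lebesgue_on \<Omega>)"
    using \<rho> by (auto simp: admissible_density_def)
  have um: "u \<in> borel_measurable (lebesgue_on \<Omega>)" "integrable (lebesgue_on \<Omega>) (\<lambda>x. C * (norm (u x))\<^sup>2)"
    using u by (auto simp: L2_space_def)
  have wm: "(\<lambda>x. sqrt (\<rho> x) *\<^sub>R u x) \<in> borel_measurable (lebesgue_on \<Omega>)"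
    using m um(1) by measurable
  have "AE x in lebesgue_on \<Omega>. norm ((norm (sqrt (\<rho> x) *\<^sub>R u x))\<^sup>2) \<le> norm (C * (norm (u x))\<^sup>2)"
    using c(2)
  proof (rule eventually_mono)
    fix x assume x: "c \<le> \<rho> x \<and> \<rho> x \<le> C"
    then have "(norm (sqrt (\<rho> x) *\<^sub>R u x))\<^sup>2 = \<rho> x * (norm (u x))\<^sup>2"
      using c(1) by (simp add: power_mult_distrib)
    moreover have "\<rho> x * (norm (u x))\<^sup>2 \<le> C * (norm (u x))\<^sup>2"
      using x by (intro mult_right_mono) auto
    ultimately show "norm ((norm (sqrt (\<rho> x) *\<^sub>R u x))\<^sup>2) \<le> norm (C * (norm (u x))\<^sup>2)"
      using x c(1) by simp
  qed
  then have "integrable (lebesgue_on \<Omega>) (\<lambda>x. (norm (sqrt (\<rho> x) *\<^sub>R u x))\<^sup>2)"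
    by (intro Bochner_Integration.integrable_bound[OF um(2)] borel_measurable_power measurable_compose[OF wm borel_measurable_norm])
  with wm show ?thesis by (simp add: L2_space_def)
qed

theorem proposition2p2:
  fixes \<Omega> :: "(real^'d::{finite,wellorder}) set"
    and T :: "nat \<Rightarrow> (real^'d::_) set set"
    and S :: "nat \<Rightarrow> (real^'d::_ \<Rightarrow> real) set"
    and V :: "nat \<Rightarrow> (real^'d::_ \<Rightarrow> real^'d::_) set"
    and \<phi> :: "nat \<Rightarrow> real^'d::_ \<Rightarrow> real" and \<phi>Hh :: "real^'d::_ \<Rightarrow> real"
    and \<rho> :: "nat \<Rightarrow> real^'d::_ \<Rightarrow> real"
    and u \<zeta> :: "nat \<Rightarrow> real^'d::_ \<Rightarrow> real^'d::_" and \<zeta>Hh :: "real^'d::_ \<Rightarrow> real^'d::_"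
    and gh gH :: "nat \<Rightarrow> nat \<Rightarrow> real^'d::_ \<Rightarrow> real^'d::_" \<comment> \<open>history index \<open>j\<close> first, then time level\<close>
    and \<tau> Cn s :: real and k n :: nat
  assumes dim: "CARD('d) \<in> {2, 3}"
    and domain: "polyhedral_domain \<Omega>"
    and pos: "\<tau> > 0" "Cn > 0" "s > 0"
    and k: "k \<in> {1, 2}" and n: "k = 2 \<Longrightarrow> n \<ge> 1"
    \<comment> \<open>the time levels entering step \<open>n \<rightarrow> n+1\<close> are \<open>n, n+1\<close> for \<open>k = 1\<close> and \<open>n-1, n, n+1\<close> for \<open>k = 2\<close>\<close>
    and mesh: "\<And>l. l \<in> {n+1-k..n+1} \<Longrightarrow> conforming_triangulation \<Omega> (T l)"
    and scalar_space: "\<And>l. l \<in> {n+1-k..n+1} \<Longrightarrow> scalar_fe_space \<Omega> (T l) (S l)"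
    and vector_space: "\<And>l. l \<in> {n+1-k..n+1} \<Longrightarrow> vector_fe_space \<Omega> (T l) (V l)"
    and phase: "\<And>l. l \<in> {n+1-k..n+1} \<Longrightarrow> \<phi> l \<in> S l"
    and phase_rep: "current_representative \<Omega> Cn s (S (n+1)) (phase_history k n \<phi>) \<phi>Hh"
    and velocity: "\<And>l. l \<in> {n+1-k..n+1} \<Longrightarrow> u l \<in> V l"
    and density: "\<And>l. l \<in> {n+1-k..n+1} \<Longrightarrow> admissible_density \<Omega> (\<rho> l)"
    and zeta: "\<And>l. l \<in> {n+1-k..n+1} \<Longrightarrow> ae_eq \<Omega> (\<zeta> l) (\<lambda>x. sqrt (\<rho> l x) *\<^sub>R u l x)"
    and g0: "\<And>l. l \<in> {n+1-k..n+1} \<Longrightarrow> ae_eq \<Omega> (gh 0 l) (\<zeta> l)"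
    and g1: "\<And>l. k = 2 \<Longrightarrow> l \<in> {n, n+1} \<Longrightarrow> ae_eq \<Omega> (gh 1 l) (\<lambda>x. 2 *\<^sub>R \<zeta> l x - gH 0 l x)"
    and transfer_prev: "k = 2 \<Longrightarrow>
      kinetic_transfer \<Omega> (T (n-1)) (T n) {0} (\<lambda>j. gh j (n-1)) (\<lambda>j. gH j n)"
    and transfer: "kinetic_transfer \<Omega> (T n) (T (n+1)) {..<k} (\<lambda>j. gh j n) (\<lambda>j. gH j (n+1))"
    and zeta_H1: "k = 1 \<Longrightarrow> ae_eq \<Omega> \<zeta>Hh (gH 0 (n+1))"
    and zeta_H2: "k = 2 \<Longrightarrow>
      ae_eq \<Omega> \<zeta>Hh (\<lambda>x. (1/3) *\<^sub>R (2 *\<^sub>R gH 0 (n+1) x + gH 1 (n+1) x))"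
  shows
    "(k = 1 \<longrightarrow>
        \<tau> * (Cn\<^sup>2 * L2_inner \<Omega> (weak_grad \<Omega> (\<phi> (n+1)))
                (weak_grad \<Omega> (\<lambda>x. bdf_gamma k / \<tau> * (\<phi> (n+1) x - \<phi>Hh x)))
             + s * L2_inner \<Omega> (\<phi> (n+1)) (\<lambda>x. bdf_gamma k / \<tau> * (\<phi> (n+1) x - \<phi>Hh x)))
        = 1/2 * (Cns_normsq \<Omega> Cn s (\<phi> (n+1)) - Cns_normsq \<Omega> Cn s (\<phi> n)
                 + Cns_normsq \<Omega> Cn s (\<lambda>x. \<phi> (n+1) x - \<phi> n x))) \<and>
     (k = 2 \<longrightarrow>
        \<tau> * (Cn\<^sup>2 * L2_inner \<Omega> (weak_grad \<Omega> (\<phi> (n+1)))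
                (weak_grad \<Omega> (\<lambda>x. bdf_gamma k / \<tau> * (\<phi> (n+1) x - \<phi>Hh x)))
             + s * L2_inner \<Omega> (\<phi> (n+1)) (\<lambda>x. bdf_gamma k / \<tau> * (\<phi> (n+1) x - \<phi>Hh x)))
        = 1/4 * (Cns_normsq \<Omega> Cn s (\<phi> (n+1))
                 + Cns_normsq \<Omega> Cn s (\<lambda>x. 2 * \<phi> (n+1) x - \<phi> n x)
                 - Cns_normsq \<Omega> Cn s (\<phi> n)
                 - Cns_normsq \<Omega> Cn s (\<lambda>x. 2 * \<phi> n x - \<phi> (n-1) x)
                 + Cns_normsq \<Omega> Cn s (\<lambda>x. \<phi> (n+1) x - 2 * \<phi> n x + \<phi> (n-1) x))) \<and>
     (k = 1 \<longrightarrow>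
        bdf_gamma k * L2_inner \<Omega> (\<lambda>x. \<zeta> (n+1) x - \<zeta>Hh x) (\<zeta> (n+1))
        = 1/2 * ((L2_norm \<Omega> (gh 0 (n+1)))\<^sup>2 - (L2_norm \<Omega> (gh 0 n))\<^sup>2
                 + (L2_norm \<Omega> (\<lambda>x. \<zeta> (n+1) x - gH 0 (n+1) x))\<^sup>2)) \<and>
     (k = 2 \<longrightarrow>
        bdf_gamma k * L2_inner \<Omega> (\<lambda>x. \<zeta> (n+1) x - \<zeta>Hh x) (\<zeta> (n+1))
        = 1/4 * ((L2_norm \<Omega> (gh 0 (n+1)))\<^sup>2 + (L2_norm \<Omega> (gh 1 (n+1)))\<^sup>2
                 - (L2_norm \<Omega> (gh 0 n))\<^sup>2 - (L2_norm \<Omega> (gh 1 n))\<^sup>2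
                 + (L2_norm \<Omega> (\<lambda>x. \<zeta> (n+1) x - gH 1 (n+1) x))\<^sup>2))"
proof -
  note \<Omega> = polyhedral_domain_simps[OF domain]
  have levels: "n \<in> {n+1-k..n+1}" "n+1 \<in> {n+1-k..n+1}" "k = 2 \<Longrightarrow> n-1 \<in> {n+1-k..n+1}"
    using k n by auto
  have S_H1: "v \<in> H1_space \<Omega>" if "l \<in> {n+1-k..n+1}" "v \<in> S l" for v l
    using scalar_space[OF that(1)] that(2) by (auto simp: scalar_fe_space_def)
  have phi: "\<phi> l \<in> H1_space \<Omega>" if "l \<in> {n+1-k..n+1}" for l
    using S_H1[OF that phase[OF that]] .
  have phiH: "\<phi>Hh \<in> H1_space \<Omega>"
    using phase_rep S_H1[OF levels(2)] by (simp add: current_representative_def)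
  have rep: "energy \<Omega> Cn s \<phi>Hh (\<phi> (n+1)) = energy \<Omega> Cn s (phase_history k n \<phi>) (\<phi> (n+1))"
    using phase_rep phase[OF levels(2)] by (simp add: current_representative_def energy_def)
  have zeta_L2: "\<zeta> l \<in> L2_space \<Omega>" if "l \<in> {n+1-k..n+1}" for l
    using L2_space_ae_eq[OF \<Omega>(4) density_scaled_L2_space[OF \<Omega>(4) vector_space[OF that] velocity[OF that] density[OF that]]
        ae_eq_sym[OF zeta[OF that]]] .
  have g0_L2: "gh 0 l \<in> L2_space \<Omega>" and g0_norm: "L2_norm \<Omega> (gh 0 l) = L2_norm \<Omega> (\<zeta> l)"
    if "l \<in> {n+1-k..n+1}" for l
    using L2_space_ae_eq[OF \<Omega>(4) zeta_L2[OF that] ae_eq_sym[OF g0[OF that]]]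
      L2_norm_cong[OF \<Omega>(4) zeta_L2[OF that] ae_eq_sym[OF g0[OF that]]] by auto
  \<comment> \<open>The premise on \<open>gH 0 l\<close> is met by the current transfer at level
    \<open>n+1\<close> and by the preceding one at level \<open>n\<close>.\<close>
  have g1_L2: "gh 1 l \<in> L2_space \<Omega>"
    and g1_norm: "L2_norm \<Omega> (gh 1 l) = L2_norm \<Omega> (\<lambda>x. 2 *\<^sub>R \<zeta> l x - gH 0 l x)"
    if "k = 2" "l \<in> {n, n+1}" "gH 0 l \<in> L2_space \<Omega>" for l
  proof -
    have "l \<in> {n+1-k..n+1}" using that levels by auto
    then have L2: "(\<lambda>x. 2 *\<^sub>R \<zeta> l x - gH 0 l x) \<in> L2_space \<Omega>"
      using L2_space_lincomb[OF zeta_L2 that(3), of l 2 "-1"] by simp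
    show "gh 1 l \<in> L2_space \<Omega>" "L2_norm \<Omega> (gh 1 l) = L2_norm \<Omega> (\<lambda>x. 2 *\<^sub>R \<zeta> l x - gH 0 l x)"
      using L2_space_ae_eq[OF \<Omega>(4) L2 ae_eq_sym[OF g1[OF that(1,2)]]]
        L2_norm_cong[OF \<Omega>(4) L2 ae_eq_sym[OF g1[OF that(1,2)]]] by auto
  qed
  note iso = kinetic_transfer_isometry[OF \<Omega>(4) mesh[OF levels(1)] mesh[OF levels(2)] transfer]
  have gH0: "gH 0 (n+1) \<in> L2_space \<Omega>" "L2_norm \<Omega> (gH 0 (n+1)) = L2_norm \<Omega> (gh 0 n)"
    using iso[of 0] g0_L2[OF levels(1)] k by auto
  have kinetic: "L2_inner \<Omega> (\<lambda>x. \<zeta> (n+1) x - \<zeta>Hh x) (\<zeta> (n+1)) = L2_inner \<Omega> (\<lambda>x. \<zeta> (n+1) x - h x) (\<zeta> (n+1))"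
    if "h \<in> L2_space \<Omega>" "ae_eq \<Omega> \<zeta>Hh h" for h
  proof (rule L2_inner_cong[OF \<Omega>(4), symmetric])
    show "(\<lambda>x. \<zeta> (n+1) x - h x) \<in> L2_space \<Omega>"
      using L2_space_lincomb[OF zeta_L2[OF levels(2)] that(1), of 1 "-1"] by simp
    show "ae_eq \<Omega> (\<lambda>x. \<zeta> (n+1) x - h x) (\<lambda>x. \<zeta> (n+1) x - \<zeta>Hh x)"
      using that(2) unfolding ae_eq_def by (rule eventually_mono) simp
  qed (use zeta_L2[OF levels(2)] in \<open>auto simp: ae_eq_def\<close>)
  show ?thesis
  proof (intro conjI impI)
    assume k1: "k = 1"
    have "energy \<Omega> Cn s \<phi>Hh (\<phi> (n+1)) = energy \<Omega> Cn s (\<phi> n) (\<phi> (n+1))"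
      using rep k1 by (simp add: phase_history_def)
    from phase_identity_1[OF \<Omega>(1,3) pos(1) phi[OF levels(2)] phi[OF levels(1)] phiH this]
    show "\<tau> * (Cn\<^sup>2 * L2_inner \<Omega> (weak_grad \<Omega> (\<phi> (n+1)))
                (weak_grad \<Omega> (\<lambda>x. bdf_gamma k / \<tau> * (\<phi> (n+1) x - \<phi>Hh x)))
             + s * L2_inner \<Omega> (\<phi> (n+1)) (\<lambda>x. bdf_gamma k / \<tau> * (\<phi> (n+1) x - \<phi>Hh x)))
        = 1/2 * (Cns_normsq \<Omega> Cn s (\<phi> (n+1)) - Cns_normsq \<Omega> Cn s (\<phi> n)
                 + Cns_normsq \<Omega> Cn s (\<lambda>x. \<phi> (n+1) x - \<phi> n x))"
      using k1 by (simp add: energy_def bdf_gamma_def)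
  next
    assume k2: "k = 2"
    have "energy \<Omega> Cn s \<phi>Hh (\<phi> (n+1)) = energy \<Omega> Cn s (\<lambda>x. (4 * \<phi> n x - \<phi> (n-1) x) / 3) (\<phi> (n+1))"
      using rep k2 by (simp add: phase_history_def)
    from phase_identity_2[OF \<Omega>(1,3) pos(1) phi[OF levels(2)] phi[OF levels(1)] phi[OF levels(3)[OF k2]] phiH this]
    show "\<tau> * (Cn\<^sup>2 * L2_inner \<Omega> (weak_grad \<Omega> (\<phi> (n+1)))
                (weak_grad \<Omega> (\<lambda>x. bdf_gamma k / \<tau> * (\<phi> (n+1) x - \<phi>Hh x)))
             + s * L2_inner \<Omega> (\<phi> (n+1)) (\<lambda>x. bdf_gamma k / \<tau> * (\<phi> (n+1) x - \<phi>Hh x)))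
        = 1/4 * (Cns_normsq \<Omega> Cn s (\<phi> (n+1))
                 + Cns_normsq \<Omega> Cn s (\<lambda>x. 2 * \<phi> (n+1) x - \<phi> n x)
                 - Cns_normsq \<Omega> Cn s (\<phi> n)
                 - Cns_normsq \<Omega> Cn s (\<lambda>x. 2 * \<phi> n x - \<phi> (n-1) x)
                 + Cns_normsq \<Omega> Cn s (\<lambda>x. \<phi> (n+1) x - 2 * \<phi> n x + \<phi> (n-1) x))"
      using k2 by (simp add: energy_def bdf_gamma_def)
  next
    assume k1: "k = 1"
    \<comment> \<open>The isometry is read backwards: the norm of the old history becomes that of
      the transferred one, leaving an identity between \<zeta>(n+1) and \<open>gH 0 (n+1)\<close>
      alone.\<close>
    show "bdf_gamma k * L2_inner \<Omega> (\<lambda>x. \<zeta> (n+1) x - \<zeta>Hh x) (\<zeta> (n+1))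
        = 1/2 * ((L2_norm \<Omega> (gh 0 (n+1)))\<^sup>2 - (L2_norm \<Omega> (gh 0 n))\<^sup>2
                 + (L2_norm \<Omega> (\<lambda>x. \<zeta> (n+1) x - gH 0 (n+1) x))\<^sup>2)"
      unfolding kinetic[OF gH0(1) zeta_H1[OF k1]] kinetic_identity_1[OF zeta_L2[OF levels(2)] gH0(1)]
        g0_norm[OF levels(2)] gH0(2)[symmetric]
      using k1 by (simp add: bdf_gamma_def)
  next
    assume k2: "k = 2"
    \<comment> \<open>\<open>gh 1 n\<close> is a combination of \<zeta>(n) and
      \<open>gH 0 n\<close>; only after the preceding transfer has shown the latter
      square-integrable does the isometry apply to the second history.\<close>
    have "gH 0 n \<in> L2_space \<Omega>"
      using kinetic_transfer_isometry(1)[OF \<Omega>(4) mesh[OF levels(3)[OF k2]] mesh[OF levels(1)] transfer_prev[OF k2], of 0]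
        g0_L2[OF levels(3)[OF k2]] by simp
    then have "gh 1 n \<in> L2_space \<Omega>" using k2 by (intro g1_L2) auto
    then have gH1: "gH 1 (n+1) \<in> L2_space \<Omega>" "L2_norm \<Omega> (gH 1 (n+1)) = L2_norm \<Omega> (gh 1 n)"
      using iso[of 1] k2 by auto
    have h: "(\<lambda>x. (1/3) *\<^sub>R (2 *\<^sub>R gH 0 (n+1) x + gH 1 (n+1) x)) \<in> L2_space \<Omega>"
      using L2_space_lincomb[OF gH0(1) gH1(1), of "2/3" "1/3"] by (simp add: scaleR_add_right)
    \<comment> \<open>With z = \<zeta>(n+1) and the transferred histories as a and b, the term 2z -
      a is the updated \<open>gh 1 (n+1)\<close>, and the norms of a and b are those of the
      histories at level \<open>n\<close>.\<close>
    show "bdf_gamma k * L2_inner \<Omega> (\<lambda>x. \<zeta> (n+1) x - \<zeta>Hh x) (\<zeta> (n+1))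
        = 1/4 * ((L2_norm \<Omega> (gh 0 (n+1)))\<^sup>2 + (L2_norm \<Omega> (gh 1 (n+1)))\<^sup>2
                 - (L2_norm \<Omega> (gh 0 n))\<^sup>2 - (L2_norm \<Omega> (gh 1 n))\<^sup>2
                 + (L2_norm \<Omega> (\<lambda>x. \<zeta> (n+1) x - gH 1 (n+1) x))\<^sup>2)"
      using kinetic_identity_2[OF zeta_L2[OF levels(2)] gH0(1) gH1(1)]
        kinetic[OF h zeta_H2[OF k2]] g0_norm[OF levels(2)] gH0 gH1(2) g1_norm[OF k2 _ gH0(1)] k2
      by (simp add: bdf_gamma_def)
  qed
qed

end
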